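(* Let $\tau,\delta>0$, and let $$C_{\max}=\max\Big(\max_{i,j}C^v_{i,j},\ \max_{i,j}C^h_{i,j}\Big),\qquad L=\frac{12}{\tau}+\frac1\delta C_{\max}^2.$$ Let $(U^k,V^{v,k},V^{h,k})$ and $(W^{v,k},W^{h,k})$ be the sequences produced by the IRLS algorithm (defined in the context), and for each iteration $k\ge0$ define the candidate solutions $$\tilde U^k=U^k-\frac1{\tau L}\Big(S^\top(SU^k-G^v-V^{v,k})+(U^kT-G^h-V^{h,k})T^\top\Big),$$ $$\tilde V^{v,k}=V^{v,k}-\frac1L\Big(C^v\odot C^v\odot\tfrac1{W^{v,k}}\odot V^{v,k}+\tfrac1\tau(V^{v,k}-SU^k+G^v)\Big),$$ $$\tilde V^{h,k}=V^{h,k}-\frac1L\Big(C^h\odot C^h\odot\tfrac1{W^{h,k}}\odot V^{h,k}+\tfrac1\tau(V^{h,k}-U^kT+G^h)\Big).$$ Suppose that at each iteration $k$ the approximate solutions of the linear system satisfy $$H_\delta(U^{k+1},V^{v,k+1},V^{h,k+1},W^{v,k},W^{h,k})\le H_\delta(\tilde U^k,\tilde V^{v,k},\tilde V^{h,k},W^{v,k},W^{h,k}).$$ Then, after $K\ge2$ iterations, $$F_\delta(U^K,V^{v,K},V^{h,K})-F_\delta^*\ \le\ \max\left(\Big(\frac12\Big)^{\frac{K-1}{2}},\ \frac{8LR^2}{K-1}\right),$$ where $F_\delta^*$ is the minimum of $F_\delta$ over $\mathbf{C_0}\times\mathbb{R}^{(N-1)\times M}\times\mathbb{R}^{N\times(M-1)}$,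 and $$R=\max_{Y\in\Gamma}\{\|Y-Y^*\| : H_\delta(Y)\le H_\delta(Y_0)\}.$$ Here $\Gamma$ is the set of $Y=(U,V^v,V^h,W^v,W^h)$ with $U\in\mathbf{C_0}$, $V^v\in\mathbb{R}^{(N-1)\times M}$, $V^h\in\mathbb{R}^{N\times(M-1)}$, and $W^v\in\mathbb{R}^{(N-1)\times M}$, $W^h\in\mathbb{R}^{N\times(M-1)}$ with all entries $\ge\delta/2$; $Y_0=(U^0,V^{v,0},V^{h,0},W^{v,0},W^{h,0})$; and $Y^*=(U^*,V^{v,*},V^{h,*},W^{v,*},W^{h,*})$, where $(U^*,V^{v,*},V^{h,*})$ is the minimizer of $F_\delta$ over $\mathbf{C_0}\times\mathbb{R}^{(N-1)\times M}\times\mathbb{R}^{N\times(M-1)}$ and, entrywise, $W^{v,*}_{i,j}=\sqrt{(C^v_{i,j})^2(V^{v,*}_{i,j})^2+\delta^2}$, $W^{h,*}_{i,j}=\sqrt{(C^h_{i,j})^2(V^{h,*}_{i,j})^2+\delta^2}$.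
   Context: $N,M\ge2$ are integers; $\mathbf{C_0}=\{U\in\mathbb{R}^{N\times M}:\sum_{i,j}U_{i,j}=0\}$. $C^v\in\mathbb{R}^{(N-1)\times M}$, $C^h\in\mathbb{R}^{N\times(M-1)}$ are given matrices with strictly positive entries; $G^v\in\mathbb{R}^{(N-1)\times M}$, $G^h\in\mathbb{R}^{N\times(M-1)}$ are given real matrices (input data of the algorithm). $S\in\mathbb{R}^{(N-1)\times N}$ has $S_{i,i+1}=1$, $S_{i,i}=-1$, other entries $0$; $T\in\mathbb{R}^{M\times(M-1)}$ has $T_{j+1,j}=1$, $T_{j,j}=-1$, other entries $0$. $\odot$ is the entrywise product, $\frac1W$ the entrywise inverse; $\|\cdot\|$ is the Frobenius norm of a matrix and, for a tuple of matrices, the Euclidean norm of all their entries. Functions: $$F_\delta(U,V^v,V^h)=\sum_{i=1}^{N-1}\sum_{j=1}^{M}\sqrt{(C^v_{i,j})^2(V^v_{i,j})^2+\delta^2}+\sum_{i=1}^{N}\sum_{j=1}^{M-1}\sqrt{(C^h_{i,j})^2(V^h_{i,j})^2+\delta^2}+\frac1{2\tau}\|SU-G^v-V^v\|^2+\frac1{2\tau}\|UT-G^h-V^h\|^2,$$ $$H_\delta(U,V^v,V^h,W^v,W^h)=\frac12\sum_{i=1}^{N-1}\sum_{j=1}^{M}\left[\frac{(C^v_{i,j})^2(V^v_{i,j})^2+\delta^2}{W^v_{i,j}}+W^v_{i,j}\right]+\frac12\sum_{i=1}^{N}\sum_{j=1}^{M-1}\left[\frac{(C^h_{i,j})^2(V^h_{i,j})^2+\delta^2}{W^h_{i,j}}+W^h_{i,j}\right]+\frac1{2\tau}\|SU-G^v-V^v\|^2+\frac1{2\tau}\|UT-G^h-V^h\|^2.$$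 IRLS algorithm. Initialize $U^0=0$, $V^{v,0}=SU^0-G^v$, $V^{h,0}=U^0T-G^h$. For $k=0,1,\dots$: (1) set $W^{v,k}_{i,j}=\sqrt{(C^v_{i,j})^2(V^{v,k}_{i,j})^2+\delta^2}$ and $W^{h,k}_{i,j}=\sqrt{(C^h_{i,j})^2(V^{h,k}_{i,j})^2+\delta^2}$; (2) choose $(U^{k+1},V^{v,k+1},V^{h,k+1})$ as an approximate solution of the linear system $S^\top SU+UTT^\top-S^\top V^v-V^hT^\top=S^\top G^v+G^hT^\top$, $C^v\odot C^v\odot\frac1{W^{v,k}}\odot V^v+\frac1\tau(V^v-SU)=-\frac1\tau G^v$, $C^h\odot C^h\odot\frac1{W^{h,k}}\odot V^h+\frac1\tau(V^h-UT)=-\frac1\tau G^h$ (the only accuracy requirement on the approximate solution is the inequality assumed in the claim); (3) replace $U^{k+1}$ by $U^{k+1}-\frac1{NM}\sum_{i,j}U^{k+1}_{i,j}$ (subtracted from every entry), so that $U^{k+1}\in\mathbf{C_0}$. (Step (3) does not change the value of $H_\delta$ or $F_\delta$.) *)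

theory Defs
  imports Complex_Main "Jordan_Normal_Form.Matrix"
begin

(* Matrices are indexed from 0, so the index ranges 1..N-1 and 1..M of the
   mathematical text become {..<N - 1} and {..<M}. *)

definition S_mat :: "nat \<Rightarrow> real mat" where
  "S_mat N = mat (N - 1) N (\<lambda>(i, j). if j = i + 1 then 1 else if j = i then - 1 else 0)"

definition T_mat :: "nat \<Rightarrow> real mat" where
  "T_mat M = mat M (M - 1) (\<lambda>(i, j). if i = j + 1 then 1 else if i = j then - 1 else 0)"

definition hadamard :: "real mat \<Rightarrow> real mat \<Rightarrow> real mat"  (infixl "\<odot>" 70) where
  "A \<odot> B = mat (dim_row A) (dim_col A) (\<lambda>(i, j). A $$ (i, j) * B $$ (i, j))"

definition entry_inverse :: "real mat \<Rightarrow> real mat" where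
  "entry_inverse = map_mat inverse"

definition entry_sum :: "real mat \<Rightarrow> real" where
  "entry_sum A = (\<Sum>i<dim_row A. \<Sum>j<dim_col A. A $$ (i, j))"

definition frob :: "real mat \<Rightarrow> real" where
  "frob A = sqrt (\<Sum>i<dim_row A. \<Sum>j<dim_col A. (A $$ (i, j))\<^sup>2)"

type_synonym triple = "real mat \<times> real mat \<times> real mat"
type_synonym quintuple = "real mat \<times> real mat \<times> real mat \<times> real mat \<times> real mat"

fun tuple_dist :: "quintuple \<Rightarrow> quintuple \<Rightarrow> real" where
  "tuple_dist (U, Vv, Vh, Wv, Wh) (U', Vv', Vh', Wv', Wh') =
     sqrt ((frob (U - U'))\<^sup>2 + (frob (Vv - Vv'))\<^sup>2 + (frob (Vh - Vh'))\<^sup>2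
           + (frob (Wv - Wv'))\<^sup>2 + (frob (Wh - Wh'))\<^sup>2)"

definition C0 :: "nat \<Rightarrow> nat \<Rightarrow> real mat set" where
  "C0 N M = {U \<in> carrier_mat N M. entry_sum U = 0}"

definition center :: "real mat \<Rightarrow> real mat" where
  "center U = map_mat (\<lambda>u. u - entry_sum U / (real (dim_row U) * real (dim_col U))) U"

definition feasible :: "nat \<Rightarrow> nat \<Rightarrow> triple set" where
  "feasible N M = C0 N M \<times> carrier_mat (N - 1) M \<times> carrier_mat N (M - 1)"

definition Gam :: "nat \<Rightarrow> nat \<Rightarrow> real \<Rightarrow> quintuple set" where
  "Gam N M \<delta> = {(U, Vv, Vh, Wv, Wh).
     U \<in> C0 N M \<and> Vv \<in> carrier_mat (N - 1) M \<and> Vh \<in> carrier_mat N (M - 1) \<and>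
     Wv \<in> carrier_mat (N - 1) M \<and> Wh \<in> carrier_mat N (M - 1) \<and>
     (\<forall>i<N - 1. \<forall>j<M. Wv $$ (i, j) \<ge> \<delta> / 2) \<and>
     (\<forall>i<N. \<forall>j<M - 1. Wh $$ (i, j) \<ge> \<delta> / 2)}"

definition C_max :: "real mat \<Rightarrow> real mat \<Rightarrow> real" where
  "C_max Cv Ch = max (Max (elements_mat Cv)) (Max (elements_mat Ch))"

fun F_fun :: "nat \<Rightarrow> nat \<Rightarrow> real \<Rightarrow> real \<Rightarrow> real mat \<Rightarrow> real mat \<Rightarrow> real mat \<Rightarrow> real mat \<Rightarrow> triple \<Rightarrow> real" where
  "F_fun N M \<tau> \<delta> Cv Ch Gv Gh (U, Vv, Vh) =
     (\<Sum>i<N - 1. \<Sum>j<M. sqrt ((Cv $$ (i, j))\<^sup>2 * (Vv $$ (i, j))\<^sup>2 + \<delta>\<^sup>2))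
     + (\<Sum>i<N. \<Sum>j<M - 1. sqrt ((Ch $$ (i, j))\<^sup>2 * (Vh $$ (i, j))\<^sup>2 + \<delta>\<^sup>2))
     + 1 / (2 * \<tau>) * (frob (S_mat N * U - Gv - Vv))\<^sup>2
     + 1 / (2 * \<tau>) * (frob (U * T_mat M - Gh - Vh))\<^sup>2"

fun H_fun :: "nat \<Rightarrow> nat \<Rightarrow> real \<Rightarrow> real \<Rightarrow> real mat \<Rightarrow> real mat \<Rightarrow> real mat \<Rightarrow> real mat \<Rightarrow> quintuple \<Rightarrow> real" where
  "H_fun N M \<tau> \<delta> Cv Ch Gv Gh (U, Vv, Vh, Wv, Wh) =
     1 / 2 * (\<Sum>i<N - 1. \<Sum>j<M.
        ((Cv $$ (i, j))\<^sup>2 * (Vv $$ (i, j))\<^sup>2 + \<delta>\<^sup>2) / Wv $$ (i, j) + Wv $$ (i, j))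
     + 1 / 2 * (\<Sum>i<N. \<Sum>j<M - 1.
        ((Ch $$ (i, j))\<^sup>2 * (Vh $$ (i, j))\<^sup>2 + \<delta>\<^sup>2) / Wh $$ (i, j) + Wh $$ (i, j))
     + 1 / (2 * \<tau>) * (frob (S_mat N * U - Gv - Vv))\<^sup>2
     + 1 / (2 * \<tau>) * (frob (U * T_mat M - Gh - Vh))\<^sup>2"

definition weight :: "real \<Rightarrow> real mat \<Rightarrow> real mat \<Rightarrow> real mat" where
  "weight \<delta> C V = mat (dim_row C) (dim_col C)
     (\<lambda>(i, j). sqrt ((C $$ (i, j))\<^sup>2 * (V $$ (i, j))\<^sup>2 + \<delta>\<^sup>2))"

fun with_weights :: "real \<Rightarrow> real mat \<Rightarrow> real mat \<Rightarrow> triple \<Rightarrow> quintuple" where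
  "with_weights \<delta> Cv Ch (U, Vv, Vh) = (U, Vv, Vh, weight \<delta> Cv Vv, weight \<delta> Ch Vh)"

(* In the update step, (Uhat, V^{v,k+1}, V^{h,k+1}) is the approximate solution of

     S^T S U + U T T^T - S^T V^v - V^h T^T = S^T G^v + G^h T^T
     C^v . C^v . (1/W^{v,k}) . V^v + (1/tau) (V^v - S U) = - (1/tau) G^v
     C^h . C^h . (1/W^{h,k}) . V^h + (1/tau) (V^h - U T) = - (1/tau) G^h

   and U^{k+1} is its U-part made mean-free.  "Approximate" constrains the solution only
   through the descent inequality against the candidate below, which is a separate
   hypothesis; hence here the triple is an arbitrary one of the right dimensions. *)
definition irls_sequence ::
  "nat \<Rightarrow> nat \<Rightarrow> real \<Rightarrow> real mat \<Rightarrow> real mat \<Rightarrow> real mat \<Rightarrow> real mat \<Rightarrow>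
   (nat \<Rightarrow> real mat) \<Rightarrow> (nat \<Rightarrow> real mat) \<Rightarrow> (nat \<Rightarrow> real mat) \<Rightarrow>
   (nat \<Rightarrow> real mat) \<Rightarrow> (nat \<Rightarrow> real mat) \<Rightarrow> bool" where
  "irls_sequence N M \<delta> Cv Ch Gv Gh U Vv Vh Wv Wh \<longleftrightarrow>
     U 0 = 0\<^sub>m N M \<and>
     Vv 0 = S_mat N * U 0 - Gv \<and>
     Vh 0 = U 0 * T_mat M - Gh \<and>
     (\<forall>k. Wv k = weight \<delta> Cv (Vv k) \<and> Wh k = weight \<delta> Ch (Vh k)) \<and>
     (\<forall>k. \<exists>Uhat \<in> carrier_mat N M. U (Suc k) = center Uhat) \<and>
     (\<forall>k. Vv (Suc k) \<in> carrier_mat (N - 1) M \<and> Vh (Suc k) \<in> carrier_mat N (M - 1))"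

fun candidate ::
  "nat \<Rightarrow> nat \<Rightarrow> real \<Rightarrow> real \<Rightarrow> real mat \<Rightarrow> real mat \<Rightarrow> real mat \<Rightarrow> real mat \<Rightarrow> quintuple \<Rightarrow> quintuple" where
  "candidate N M \<tau> L Cv Ch Gv Gh (U, Vv, Vh, Wv, Wh) =
     (U - 1 / (\<tau> * L) \<cdot>\<^sub>m (transpose_mat (S_mat N) * (S_mat N * U - Gv - Vv)
                        + (U * T_mat M - Gh - Vh) * transpose_mat (T_mat M)),
      Vv - 1 / L \<cdot>\<^sub>m (Cv \<odot> Cv \<odot> entry_inverse Wv \<odot> Vv + 1 / \<tau> \<cdot>\<^sub>m (Vv - S_mat N * U + Gv)),
      Vh - 1 / L \<cdot>\<^sub>m (Ch \<odot> Ch \<odot> entry_inverse Wh \<odot> Vh + 1 / \<tau> \<cdot>\<^sub>m (Vh - U * T_mat M + Gh)),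
      Wv, Wh)"

end

theory Submission
  imports Defs "HOL-Analysis.Function_Topology" "HOL-Analysis.L2_Norm"
    "HOL-Analysis.Elementary_Metric_Spaces"
begin

text \<open>
  Freezing the weights at \<open>W\<^sub>k = weight (V\<^sub>k)\<close> turns \<open>F\<close> into the quadratic majorizer
  \<open>H(\<cdot>, W\<^sub>k)\<close>: it lies above \<open>F\<close> everywhere and agrees with \<open>F\<close> to first order at the current
  iterate \<open>X\<^sub>k = (U\<^sub>k, V\<^sub>k)\<close>.  Hence the gradient \<open>g\<^sub>k\<close> of \<open>H(\<cdot>, W\<^sub>k)\<close> at \<open>X\<^sub>k\<close> is also the
  gradient of \<open>F\<close> there, and the candidate is a gradient step of length \<open>1 / L\<close> for both.

  Since all weights are at least \<open>\<delta>\<close>, the Hessian of \<open>H(\<cdot>, W\<^sub>k)\<close> is bounded by \<open>L\<close>; the constant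
  12 arises because each entry of \<open>U\<close> occurs in at most four differences and
  \<open>(a - b - c)\<^sup>2 \<le> 3 (a\<^sup>2 + b\<^sup>2 + c\<^sup>2)\<close>.  So the gradient step lowers \<open>H(\<cdot>, W\<^sub>k)\<close> by at least
  \<open>|g\<^sub>k|\<^sup>2 / (2 L)\<close> (\<open>H_descent\<close>), and an iterate at least as good as the candidate satisfies
  \<open>F X\<^sub>k\<^sub>+\<^sub>1 \<le> F X\<^sub>k - |g\<^sub>k|\<^sup>2 / (2 L)\<close>.  Convexity of \<open>F\<close> (\<open>F_above_tangent\<close>) and Cauchy-Schwarz bound
  the gap \<open>a\<^sub>k = F X\<^sub>k - Fstar\<close> by \<open>|g\<^sub>k| R\<close>.  Together, \<open>a\<^sub>k\<^sup>2 \<le> 2 L R\<^sup>2 (a\<^sub>k - a\<^sub>k\<^sub>+\<^sub>1)\<close>, which forces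
  \<open>K a\<^sub>K \<le> 2 L R\<^sup>2\<close> (\<open>quadratic_recursion_rate\<close>), hence
  \<open>a\<^sub>K \<le> 8 L R\<^sup>2 / (K - 1)\<close>.

  It remains to see that the minimum of \<open>F\<close> and the maximum defining \<open>R\<close> are attained.  Both follow
  from compactness of the sublevel sets of \<open>H\<close> on \<open>Gam\<close> (\<open>sublevel_compact_image\<close>): a bound on \<open>H\<close>
  bounds the weights, then \<open>V\<close>, then the differences of \<open>U\<close>, and a matrix of entry sum zero is
  controlled by its differences.  A minimizer of \<open>H\<close> yields one of \<open>F\<close>, because \<open>F\<close> is the
  minimum of \<open>H\<close> over the weights.
\<close>

section \<open>The Frobenius inner product\<close>

definition frob_inner :: "real mat \<Rightarrow> real mat \<Rightarrow> real" where
  "frob_inner A B = (\<Sum>i<dim_row A. \<Sum>j<dim_col A. A $$ (i, j) * B $$ (i, j))"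

lemma frob_inner_eq:
  "A \<in> carrier_mat n m \<Longrightarrow> frob_inner A B = (\<Sum>i<n. \<Sum>j<m. A $$ (i, j) * B $$ (i, j))"
  by (simp add: frob_inner_def)

lemma frob_square:
  "A \<in> carrier_mat n m \<Longrightarrow> (frob A)\<^sup>2 = (\<Sum>i<n. \<Sum>j<m. (A $$ (i, j))\<^sup>2)"
  by (auto simp: frob_def sum_nonneg)

lemma frob_inner_self: "frob_inner A A = (frob A)\<^sup>2"
  using frob_square[of A "dim_row A" "dim_col A"] by (simp add: frob_inner_def power2_eq_square)

lemma frob_inner_le: "\<bar>frob_inner A B\<bar> \<le> frob A * frob B"
  if "A \<in> carrier_mat n m" "B \<in> carrier_mat n m"
proof -
  have "\<bar>frob_inner A B\<bar> \<le> (\<Sum>p\<in>{..<n} \<times> {..<m}. \<bar>A $$ p\<bar> * \<bar>B $$ p\<bar>)"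
    using that by (simp add: frob_inner_eq sum.cartesian_product order.trans[OF sum_abs] flip: abs_mult)
  also have "\<dots> \<le> L2_set (($$) A) ({..<n} \<times> {..<m}) * L2_set (($$) B) ({..<n} \<times> {..<m})"
    by (rule L2_set_mult_ineq)
  also have "\<dots> = frob A * frob B"
    using that by (simp add: frob_def L2_set_def sum.cartesian_product)
  finally show ?thesis .
qed

lemma frob_inner_scale:
  "A \<in> carrier_mat n m \<Longrightarrow> B \<in> carrier_mat n m \<Longrightarrow>
     frob_inner A (c \<cdot>\<^sub>m B) = c * frob_inner A B"
  by (simp add: frob_inner_eq sum_distrib_left mult.left_commute)

lemma frob_inner_scale_left:
  "A \<in> carrier_mat n m \<Longrightarrow> frob_inner (c \<cdot>\<^sub>m A) B = c * frob_inner A B"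
  by (simp add: frob_inner_def sum_distrib_left mult.assoc)

lemma frob_inner_add_left:
  "A \<in> carrier_mat n m \<Longrightarrow> B \<in> carrier_mat n m \<Longrightarrow>
     frob_inner (A + B) D = frob_inner A D + frob_inner B D"
  by (simp add: frob_inner_def sum.distrib ring_distribs)

lemma frob_inner_diff_right:
  "A \<in> carrier_mat n m \<Longrightarrow> B \<in> carrier_mat n m \<Longrightarrow> D \<in> carrier_mat n m \<Longrightarrow>
     frob_inner A (B - D) = frob_inner A B - frob_inner A D"
  by (simp add: frob_inner_eq sum_subtractf ring_distribs)

lemma frob_square_add:
  "A \<in> carrier_mat n m \<Longrightarrow> B \<in> carrier_mat n m \<Longrightarrow>
     (frob (A + B))\<^sup>2 = (frob A)\<^sup>2 + 2 * frob_inner A B + (frob B)\<^sup>2"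
  by (simp add: frob_inner_eq frob_square[where A = "A + B" and n = n and m = m]
      frob_square[where A = A and n = n and m = m] frob_square[where A = B and n = n and m = m]
      power2_sum sum.distrib sum_distrib_left mult.assoc)

lemma frob_square_scale: "(frob (c \<cdot>\<^sub>m A))\<^sup>2 = c\<^sup>2 * (frob A)\<^sup>2"
proof -
  have A: "A \<in> carrier_mat (dim_row A) (dim_col A)" by simp
  then have "c \<cdot>\<^sub>m A \<in> carrier_mat (dim_row A) (dim_col A)" by simp
  from frob_square[OF this] frob_square[OF A] show ?thesis
    by (simp add: power_mult_distrib sum_distrib_left)
qed

lemma frob_nonneg: "0 \<le> frob A"
  by (simp add: frob_def sum_nonneg)

text \<open>
  Transposition gives the adjoint of left and of right multiplication.  This is what makes the
  U-part of the candidate's direction the gradient of the two fidelity terms.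
\<close>

lemma frob_inner_transpose_mult:
  assumes "A \<in> carrier_mat n m" "B \<in> carrier_mat n p" "D \<in> carrier_mat m p"
  shows "frob_inner (transpose_mat A * B) D = frob_inner B (A * D)"
proof -
  have "frob_inner (transpose_mat A * B) D
      = (\<Sum>i<m. \<Sum>j<p. \<Sum>k<n. A $$ (k, i) * B $$ (k, j) * D $$ (i, j))"
    using assms by (subst frob_inner_eq[of _ m p])
      (auto intro!: sum.cong simp: scalar_prod_def lessThan_atLeast0 sum_distrib_right)
  also have "\<dots> = (\<Sum>k<n. \<Sum>j<p. \<Sum>i<m. A $$ (k, i) * B $$ (k, j) * D $$ (i, j))"
    by (subst sum.swap, subst (2) sum.swap, subst sum.swap) (rule refl)
  also have "\<dots> = frob_inner B (A * D)"
    using assms by (subst frob_inner_eq[of _ n p])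
      (auto intro!: sum.cong simp: scalar_prod_def lessThan_atLeast0 sum_distrib_left)
  finally show ?thesis .
qed

lemma frob_inner_mult_transpose:
  assumes "A \<in> carrier_mat m p" "B \<in> carrier_mat n p" "D \<in> carrier_mat n m"
  shows "frob_inner (B * transpose_mat A) D = frob_inner B (D * A)"
proof -
  have "frob_inner (B * transpose_mat A) D
      = (\<Sum>i<n. \<Sum>j<m. \<Sum>k<p. B $$ (i, k) * A $$ (j, k) * D $$ (i, j))"
    using assms by (subst frob_inner_eq[of _ n m])
      (auto intro!: sum.cong simp: scalar_prod_def lessThan_atLeast0 sum_distrib_right)
  also have "\<dots> = (\<Sum>i<n. \<Sum>k<p. \<Sum>j<m. B $$ (i, k) * A $$ (j, k) * D $$ (i, j))"
    by (subst (2) sum.swap) (rule refl)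
  also have "\<dots> = frob_inner B (D * A)"
    using assms by (subst frob_inner_eq[of _ n p])
      (auto intro!: sum.cong simp: scalar_prod_def lessThan_atLeast0 sum_distrib_left)
  finally show ?thesis .
qed

section \<open>Discrete differences\<close>

lemma S_mat_carrier [simp]: "S_mat N \<in> carrier_mat (N - 1) N"
  and T_mat_carrier [simp]: "T_mat M \<in> carrier_mat M (M - 1)"
  by (simp_all add: S_mat_def T_mat_def)

lemma S_T_mat_dim [simp]:
  "dim_row (S_mat N) = N - 1" "dim_col (S_mat N) = N" "dim_row (T_mat M) = M" "dim_col (T_mat M) = M - 1"
  by (simp_all add: S_mat_def T_mat_def)

lemma S_mat_mult_entry:
  assumes "U \<in> carrier_mat N M" "i < N - 1" "j < M"
  shows "(S_mat N * U) $$ (i, j) = U $$ (i + 1, j) - U $$ (i, j)"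
proof -
  have "(S_mat N * U) $$ (i, j) = (\<Sum>k\<in>{0..<N}. S_mat N $$ (i, k) * U $$ (k, j))"
    using assms by (simp add: scalar_prod_def S_mat_def)
  also have "\<dots> = (\<Sum>k\<in>{0..<N}. (if k = i + 1 then U $$ (k, j) else 0)
                                 - (if k = i then U $$ (k, j) else 0))"
    using assms by (intro sum.cong) (auto simp: S_mat_def)
  also have "\<dots> = U $$ (i + 1, j) - U $$ (i, j)"
    using assms by (simp add: sum_subtractf)
  finally show ?thesis .
qed

lemma mult_T_mat_entry:
  assumes "U \<in> carrier_mat N M" "i < N" "j < M - 1"
  shows "(U * T_mat M) $$ (i, j) = U $$ (i, j + 1) - U $$ (i, j)"
proof -
  have "(U * T_mat M) $$ (i, j) = (\<Sum>k\<in>{0..<M}. U $$ (i, k) * T_mat M $$ (k, j))"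
    using assms by (simp add: scalar_prod_def T_mat_def)
  also have "\<dots> = (\<Sum>k\<in>{0..<M}. (if k = j + 1 then U $$ (i, k) else 0)
                                 - (if k = j then U $$ (i, k) else 0))"
    using assms by (intro sum.cong) (auto simp: T_mat_def)
  also have "\<dots> = U $$ (i, j + 1) - U $$ (i, j)"
    using assms by (simp add: sum_subtractf)
  finally show ?thesis .
qed

lemma square_diff_diff_le: "(a - b - c)\<^sup>2 \<le> 3 * (a\<^sup>2 + b\<^sup>2 + c\<^sup>2)" for a b c :: real
proof -
  have "3 * (a\<^sup>2 + b\<^sup>2 + c\<^sup>2) - (a - b - c)\<^sup>2 = (a + b)\<^sup>2 + (a + c)\<^sup>2 + (b - c)\<^sup>2"
    by (simp add: power2_eq_square algebra_simps)
  then show ?thesis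
    by (smt (verit) zero_le_power2)
qed

lemma sum_shift_le:
  fixes f :: "nat \<Rightarrow> real"
  assumes "\<And>i. i < n \<Longrightarrow> 0 \<le> f i"
  shows "(\<Sum>i<n - 1. f (i + 1)) \<le> (\<Sum>i<n. f i)" "(\<Sum>i<n - 1. f i) \<le> (\<Sum>i<n. f i)"
proof -
  have "(\<Sum>i<n - 1. f (i + 1)) = sum f ((\<lambda>i. i + 1) ` {..<n - 1})"
    by (subst sum.reindex) auto
  also have "\<dots> \<le> (\<Sum>i<n. f i)"
    using assms by (intro sum_mono2) auto
  finally show "(\<Sum>i<n - 1. f (i + 1)) \<le> (\<Sum>i<n. f i)" .
  show "(\<Sum>i<n - 1. f i) \<le> (\<Sum>i<n. f i)"
    using assms by (intro sum_mono2) auto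
qed

text \<open>
  Every row of \<open>P\<close> enters at most two vertical differences (every column at most two horizontal ones),
  so the factor 3 of \<open>square_diff_diff_le\<close> becomes 6.  Adding the vertical and the horizontal bound
  produces the 12 in the step-size constant.
\<close>

lemma frob_square_S_mat_diff_le:
  assumes "P \<in> carrier_mat N M" "Q \<in> carrier_mat (N - 1) M"
  shows "(frob (S_mat N * P - Q))\<^sup>2 \<le> 6 * (frob P)\<^sup>2 + 3 * (frob Q)\<^sup>2"
proof -
  let ?f = "\<lambda>i. \<Sum>j<M. (P $$ (i, j))\<^sup>2"
  have "(frob (S_mat N * P - Q))\<^sup>2
      = (\<Sum>i<N - 1. \<Sum>j<M. (P $$ (i + 1, j) - P $$ (i, j) - Q $$ (i, j))\<^sup>2)"
    using assms by (subst frob_square[of _ "N - 1" M]) 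
      (auto intro!: sum.cong simp del: index_mult_mat(1) simp: S_mat_mult_entry)
  also have "\<dots> \<le> (\<Sum>i<N - 1. \<Sum>j<M. 3 * ((P $$ (i + 1, j))\<^sup>2 + (P $$ (i, j))\<^sup>2 + (Q $$ (i, j))\<^sup>2))"
    by (intro sum_mono square_diff_diff_le)
  also have "\<dots> = 3 * ((\<Sum>i<N - 1. ?f (i + 1)) + (\<Sum>i<N - 1. ?f i) + (frob Q)\<^sup>2)"
    using assms by (simp add: frob_square sum.distrib flip: sum_distrib_left)
  also have "\<dots> \<le> 3 * ((frob P)\<^sup>2 + (frob P)\<^sup>2 + (frob Q)\<^sup>2)"
    using assms sum_shift_le[of N ?f] by (simp add: frob_square sum_nonneg)
  finally show ?thesis by simp
qed

lemma frob_square_T_mat_diff_le: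
  assumes "P \<in> carrier_mat N M" "Q \<in> carrier_mat N (M - 1)"
  shows "(frob (P * T_mat M - Q))\<^sup>2 \<le> 6 * (frob P)\<^sup>2 + 3 * (frob Q)\<^sup>2"
proof -
  let ?f = "\<lambda>i j. (P $$ (i, j))\<^sup>2"
  have "(frob (P * T_mat M - Q))\<^sup>2
      = (\<Sum>i<N. \<Sum>j<M - 1. (P $$ (i, j + 1) - P $$ (i, j) - Q $$ (i, j))\<^sup>2)"
    using assms by (subst frob_square[of _ N "M - 1"]) 
      (auto intro!: sum.cong simp del: index_mult_mat(1) simp: mult_T_mat_entry)
  also have "\<dots> \<le> (\<Sum>i<N. \<Sum>j<M - 1. 3 * ((P $$ (i, j + 1))\<^sup>2 + (P $$ (i, j))\<^sup>2 + (Q $$ (i, j))\<^sup>2))"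
    by (intro sum_mono square_diff_diff_le)
  also have "\<dots> = 3 * ((\<Sum>i<N. \<Sum>j<M - 1. ?f i (j + 1)) + (\<Sum>i<N. \<Sum>j<M - 1. ?f i j) + (frob Q)\<^sup>2)"
    using assms by (simp add: frob_square sum.distrib flip: sum_distrib_left)
  also have "\<dots> \<le> 3 * ((frob P)\<^sup>2 + (frob P)\<^sup>2 + (frob Q)\<^sup>2)"
    using assms sum_mono[OF sum_shift_le(1)[of M "?f i" for i], of "{..<N}" "\<lambda>i. i"]
      sum_mono[OF sum_shift_le(2)[of M "?f i" for i], of "{..<N}" "\<lambda>i. i"]
    by (simp add: frob_square)
  finally show ?thesis by simp
qed

lemma abs_increment_le:
  fixes f :: "nat \<Rightarrow> real"
  assumes "\<And>i. i < n \<Longrightarrow> \<bar>f (i + 1) - f i\<bar> \<le> D"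
  shows "\<bar>f n - f 0\<bar> \<le> real n * D"
  using assms
proof (induction n)
  case (Suc n)
  then have "\<bar>f n - f 0\<bar> \<le> real n * D" "\<bar>f (n + 1) - f n\<bar> \<le> D" by auto
  then show ?case by (simp add: ring_distribs abs_if split: if_splits)
qed simp

text \<open>
  A discrete Poincare inequality: a path from the corner to any entry takes fewer than \<open>N + M\<close> unit
  steps, so all entries are within \<open>(N + M) D\<close> of the corner entry, and since they average to zero the
  corner entry itself is at most that large.  This is the only source of coercivity in \<open>U\<close>.
\<close>

lemma mean_zero_entry_bound:
  assumes U: "U \<in> C0 N M" and D: "0 \<le> D"
    and v: "\<And>i j. i < N - 1 \<Longrightarrow> j < M \<Longrightarrow> \<bar>(S_mat N * U) $$ (i, j)\<bar> \<le> D"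
    and h: "\<And>i j. i < N \<Longrightarrow> j < M - 1 \<Longrightarrow> \<bar>(U * T_mat M) $$ (i, j)\<bar> \<le> D"
    and ij: "i < N" "j < M"
  shows "\<bar>U $$ (i, j)\<bar> \<le> 2 * (real N + real M) * D"
proof -
  have Uc: "U \<in> carrier_mat N M" and U0: "entry_sum U = 0" using U by (auto simp: C0_def)
  have d: "\<bar>U $$ (k, l) - U $$ (0, 0)\<bar> \<le> (real N + real M) * D" if "k < N" "l < M" for k l
  proof -
    have "\<bar>U $$ (k, l) - U $$ (0, l)\<bar> \<le> real k * D"
      using v S_mat_mult_entry[OF Uc] that
      by (intro abs_increment_le[of k "\<lambda>i. U $$ (i, l)"]) force
    moreover have "\<bar>U $$ (0, l) - U $$ (0, 0)\<bar> \<le> real l * D"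
      using h mult_T_mat_entry[OF Uc] that
      by (intro abs_increment_le[of l "\<lambda>j. U $$ (0, j)"]) force
    ultimately have "\<bar>U $$ (k, l) - U $$ (0, 0)\<bar> \<le> (real k + real l) * D"
      by (simp add: ring_distribs abs_if split: if_splits)
    also have "\<dots> \<le> (real N + real M) * D"
      using that D by (intro mult_right_mono) auto
    finally show ?thesis .
  qed
  have "real N * real M * U $$ (0, 0) = (\<Sum>k<N. \<Sum>l<M. U $$ (0, 0) - U $$ (k, l))"
    using Uc U0 by (simp add: entry_sum_def sum_subtractf)
  then have "real N * real M * \<bar>U $$ (0, 0)\<bar> = \<bar>\<Sum>k<N. \<Sum>l<M. U $$ (0, 0) - U $$ (k, l)\<bar>"
    by (metis abs_mult abs_of_nat)
  also have "\<dots> \<le> (\<Sum>k<N. \<Sum>l<M. \<bar>U $$ (0, 0) - U $$ (k, l)\<bar>)"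
    by (intro order.trans[OF sum_abs] sum_mono sum_abs)
  also have "\<dots> \<le> (\<Sum>k<N. \<Sum>l<M. (real N + real M) * D)"
    using d by (intro sum_mono) (simp add: abs_minus_commute)
  also have "\<dots> = real N * real M * ((real N + real M) * D)"
    by simp
  finally have "\<bar>U $$ (0, 0)\<bar> \<le> (real N + real M) * D"
    using ij by (simp add: mult_le_cancel_left)
  with d[OF ij] show ?thesis by (auto simp: ring_distribs abs_if split: if_splits)
qed


section \<open>The quadratic majorizer of the objective\<close>

text \<open>Keeps dimensions in the form \<open>N - 1\<close> in which the carrier facts are stated.\<close>

declare One_nat_def [simp del]

text \<open>The gradient in \<open>V\<close> of the weighted quadratic \<open>1 / 2 \<Sum> C\<^sup>2 V\<^sup>2 / W\<close>.\<close>

definition reweighted :: "real mat \<Rightarrow> real mat \<Rightarrow> real mat \<Rightarrow> real mat" where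
  "reweighted C W V = C \<odot> C \<odot> entry_inverse W \<odot> V"

lemma reweighted_carrier [simp]: "C \<in> carrier_mat n m \<Longrightarrow> reweighted C W V \<in> carrier_mat n m"
  by (simp add: reweighted_def hadamard_def)

lemma reweighted_entry:
  "C \<in> carrier_mat n m \<Longrightarrow> W \<in> carrier_mat n m \<Longrightarrow> V \<in> carrier_mat n m \<Longrightarrow> i < n \<Longrightarrow> j < m \<Longrightarrow>
     reweighted C W V $$ (i, j) = (C $$ (i, j))\<^sup>2 * V $$ (i, j) / W $$ (i, j)"
  by (simp add: reweighted_def hadamard_def entry_inverse_def power2_eq_square divide_inverse)

lemma weight_carrier [simp]: "C \<in> carrier_mat n m \<Longrightarrow> weight \<delta> C V \<in> carrier_mat n m"
  by (simp add: weight_def)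

lemma weight_entry:
  "C \<in> carrier_mat n m \<Longrightarrow> i < n \<Longrightarrow> j < m \<Longrightarrow>
     weight \<delta> C V $$ (i, j) = sqrt ((C $$ (i, j))\<^sup>2 * (V $$ (i, j))\<^sup>2 + \<delta>\<^sup>2)"
  by (simp add: weight_def)

lemma weight_ge:
  "C \<in> carrier_mat n m \<Longrightarrow> i < n \<Longrightarrow> j < m \<Longrightarrow> 0 < \<delta> \<Longrightarrow> \<delta> \<le> weight \<delta> C V $$ (i, j)"
  by (simp add: weight_entry real_le_rsqrt)

lemma majorizer_expansion:
  assumes "C \<in> carrier_mat n m" "W \<in> carrier_mat n m" "V \<in> carrier_mat n m" "Q \<in> carrier_mat n m"
  shows "1 / 2 * (\<Sum>i<n. \<Sum>j<m.
          ((C $$ (i, j))\<^sup>2 * ((V + Q) $$ (i, j))\<^sup>2 + \<delta>\<^sup>2) / W $$ (i, j) + W $$ (i, j))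
     = 1 / 2 * (\<Sum>i<n. \<Sum>j<m.
          ((C $$ (i, j))\<^sup>2 * (V $$ (i, j))\<^sup>2 + \<delta>\<^sup>2) / W $$ (i, j) + W $$ (i, j))
       + frob_inner (reweighted C W V) Q
       + 1 / 2 * (\<Sum>i<n. \<Sum>j<m. (C $$ (i, j))\<^sup>2 / W $$ (i, j) * (Q $$ (i, j))\<^sup>2)"
    (is "?l = _")
proof -
  have "((C $$ (i, j))\<^sup>2 * ((V + Q) $$ (i, j))\<^sup>2 + \<delta>\<^sup>2) / W $$ (i, j) + W $$ (i, j)
      = ((C $$ (i, j))\<^sup>2 * (V $$ (i, j))\<^sup>2 + \<delta>\<^sup>2) / W $$ (i, j) + W $$ (i, j)
        + 2 * (reweighted C W V $$ (i, j) * Q $$ (i, j))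
        + (C $$ (i, j))\<^sup>2 / W $$ (i, j) * (Q $$ (i, j))\<^sup>2" if "i < n" "j < m" for i j
    using assms that
    by (simp add: reweighted_entry divide_inverse power2_eq_square algebra_simps)
  then have "?l = 1 / 2 * (\<Sum>i<n. \<Sum>j<m.
        ((C $$ (i, j))\<^sup>2 * (V $$ (i, j))\<^sup>2 + \<delta>\<^sup>2) / W $$ (i, j) + W $$ (i, j)
        + 2 * (reweighted C W V $$ (i, j) * Q $$ (i, j))
        + (C $$ (i, j))\<^sup>2 / W $$ (i, j) * (Q $$ (i, j))\<^sup>2)"
    by (intro arg_cong[where f = "\<lambda>x. 1 / 2 * x"] sum.cong) auto
  also have "\<dots> = 1 / 2 * (\<Sum>i<n. \<Sum>j<m.
          ((C $$ (i, j))\<^sup>2 * (V $$ (i, j))\<^sup>2 + \<delta>\<^sup>2) / W $$ (i, j) + W $$ (i, j))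
       + (\<Sum>i<n. \<Sum>j<m. reweighted C W V $$ (i, j) * Q $$ (i, j))
       + 1 / 2 * (\<Sum>i<n. \<Sum>j<m. (C $$ (i, j))\<^sup>2 / W $$ (i, j) * (Q $$ (i, j))\<^sup>2)"
    by (simp only: sum.distrib flip: sum_distrib_left) (simp add: algebra_simps)
  finally show ?thesis
    using assms by (simp add: frob_inner_eq[of _ n m])
qed

lemma majorizer_curvature_le:
  assumes "C \<in> carrier_mat n m" "Q \<in> carrier_mat n m" "0 < \<delta>"
    and C: "\<And>i j. i < n \<Longrightarrow> j < m \<Longrightarrow> 0 \<le> C $$ (i, j) \<and> C $$ (i, j) \<le> c"
    and W: "\<And>i j. i < n \<Longrightarrow> j < m \<Longrightarrow> \<delta> \<le> W $$ (i, j)"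
  shows "(\<Sum>i<n. \<Sum>j<m. (C $$ (i, j))\<^sup>2 / W $$ (i, j) * (Q $$ (i, j))\<^sup>2) \<le> 1 / \<delta> * c\<^sup>2 * (frob Q)\<^sup>2"
proof -
  have "(C $$ (i, j))\<^sup>2 / W $$ (i, j) * (Q $$ (i, j))\<^sup>2 \<le> 1 / \<delta> * c\<^sup>2 * (Q $$ (i, j))\<^sup>2"
    if "i < n" "j < m" for i j
  proof (rule mult_right_mono)
    show "(C $$ (i, j))\<^sup>2 / W $$ (i, j) \<le> 1 / \<delta> * c\<^sup>2"
      using frac_le[of "c\<^sup>2" "(C $$ (i, j))\<^sup>2" \<delta> "W $$ (i, j)"] C[OF that] W[OF that] \<open>0 < \<delta>\<close>
      by (simp add: power_mono)
  qed simp
  then have "(\<Sum>i<n. \<Sum>j<m. (C $$ (i, j))\<^sup>2 / W $$ (i, j) * (Q $$ (i, j))\<^sup>2)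
      \<le> (\<Sum>i<n. \<Sum>j<m. 1 / \<delta> * c\<^sup>2 * (Q $$ (i, j))\<^sup>2)"
    by (intro sum_mono) auto
  then show ?thesis
    using assms by (simp add: frob_square sum_distrib_left)
qed

lemma majorizer_at_weight:
  assumes "C \<in> carrier_mat n m" "0 < \<delta>"
  shows "1 / 2 * (\<Sum>i<n. \<Sum>j<m. ((C $$ (i, j))\<^sup>2 * (V $$ (i, j))\<^sup>2 + \<delta>\<^sup>2) / weight \<delta> C V $$ (i, j)
           + weight \<delta> C V $$ (i, j))
     = (\<Sum>i<n. \<Sum>j<m. sqrt ((C $$ (i, j))\<^sup>2 * (V $$ (i, j))\<^sup>2 + \<delta>\<^sup>2))"
  using assms by (simp add: weight_entry real_div_sqrt sum_distrib_left)

text \<open>The arithmetic-geometric mean inequality, in the form \<open>(sqrt x - w)\<^sup>2 \<ge> 0\<close>.\<close>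

lemma sqrt_le_majorizer:
  fixes w x :: real
  assumes "0 < w" "0 \<le> x"
  shows "2 * sqrt x \<le> x / w + w"
proof -
  have "(sqrt x - w)\<^sup>2 \<ge> 0" by simp
  then have "2 * sqrt x * w \<le> x + w * w"
    using assms by (simp add: power2_diff power2_eq_square algebra_simps)
  then have "2 * sqrt x * w / w \<le> (x + w * w) / w"
    using assms by (intro divide_right_mono) auto
  then show ?thesis using assms by (simp add: add_divide_distrib)
qed

lemma majorizer_ge:
  assumes "\<And>i j. i < n \<Longrightarrow> j < m \<Longrightarrow> 0 < W $$ (i, j)"
  shows "(\<Sum>i<n. \<Sum>j<m. sqrt ((C $$ (i, j))\<^sup>2 * (V $$ (i, j))\<^sup>2 + \<delta>\<^sup>2))
     \<le> 1 / 2 * (\<Sum>i<n. \<Sum>j<m. ((C $$ (i, j))\<^sup>2 * (V $$ (i, j))\<^sup>2 + \<delta>\<^sup>2) / W $$ (i, j) + W $$ (i, j))"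
proof -
  have "2 * (\<Sum>i<n. \<Sum>j<m. sqrt ((C $$ (i, j))\<^sup>2 * (V $$ (i, j))\<^sup>2 + \<delta>\<^sup>2))
     \<le> (\<Sum>i<n. \<Sum>j<m. ((C $$ (i, j))\<^sup>2 * (V $$ (i, j))\<^sup>2 + \<delta>\<^sup>2) / W $$ (i, j) + W $$ (i, j))"
    unfolding sum_distrib_left using assms by (intro sum_mono sqrt_le_majorizer) auto
  then show ?thesis by simp
qed

text \<open>
  The square root is the Euclidean norm of the vector \<open>(c x, d)\<close>, which is affine in \<open>x\<close>; the tangent
  bound is Cauchy-Schwarz for the vectors at \<open>x\<close> and at \<open>x + q\<close>, divided by the norm at \<open>x\<close>.
\<close>

lemma sqrt_above_tangent:
  fixes c d x q :: real
  assumes "0 < d"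
  shows "sqrt (c\<^sup>2 * x\<^sup>2 + d\<^sup>2) + c\<^sup>2 * x / sqrt (c\<^sup>2 * x\<^sup>2 + d\<^sup>2) * q \<le> sqrt (c\<^sup>2 * (x + q)\<^sup>2 + d\<^sup>2)"
proof -
  define a where "a = sqrt (c\<^sup>2 * x\<^sup>2 + d\<^sup>2)"
  define b where "b = sqrt (c\<^sup>2 * (x + q)\<^sup>2 + d\<^sup>2)"
  have a2: "a * a = c\<^sup>2 * x\<^sup>2 + d\<^sup>2"
    by (simp add: a_def)
  have a: "0 < a" using assms by (simp add: a_def add_nonneg_pos)
  have "a * a + c\<^sup>2 * x * q = (c * x) * (c * (x + q)) + d * d"
    by (simp add: a2 power2_eq_square algebra_simps)
  \<comment> \<open>Cauchy-Schwarz in the plane, via Lagrange's identity\<close>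
  also have "\<dots> \<le> sqrt ((c * x)\<^sup>2 + d\<^sup>2) * sqrt ((c * (x + q))\<^sup>2 + d\<^sup>2)"
  proof -
    have "((c * x) * (c * (x + q)) + d * d)\<^sup>2 + (d * (c * x - c * (x + q)))\<^sup>2
        = ((c * x)\<^sup>2 + d\<^sup>2) * ((c * (x + q))\<^sup>2 + d\<^sup>2)"
      by (simp add: power2_eq_square algebra_simps)
    then have "((c * x) * (c * (x + q)) + d * d)\<^sup>2 \<le> ((c * x)\<^sup>2 + d\<^sup>2) * ((c * (x + q))\<^sup>2 + d\<^sup>2)"
      by (smt (verit) zero_le_power2)
    then show ?thesis
      by (simp add: real_le_rsqrt flip: real_sqrt_mult)
  qed
  also have "\<dots> = a * b" by (simp add: a_def b_def power_mult_distrib)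
  finally have "(a * a + c\<^sup>2 * x * q) / a \<le> a * b / a"
    using a by (intro divide_right_mono) auto
  then show ?thesis using a by (simp add: add_divide_distrib flip: a_def b_def)
qed

text \<open>
  The linear term is written with the majorizer's gradient: at the weights belonging to \<open>V\<close> it coincides
  with the gradient of the smoothed absolute values.
\<close>

lemma smoothed_above_tangent:
  assumes "C \<in> carrier_mat n m" "V \<in> carrier_mat n m" "Q \<in> carrier_mat n m" "0 < \<delta>"
  shows "(\<Sum>i<n. \<Sum>j<m. sqrt ((C $$ (i, j))\<^sup>2 * (V $$ (i, j))\<^sup>2 + \<delta>\<^sup>2))
       + frob_inner (reweighted C (weight \<delta> C V) V) Q
     \<le> (\<Sum>i<n. \<Sum>j<m. sqrt ((C $$ (i, j))\<^sup>2 * ((V + Q) $$ (i, j))\<^sup>2 + \<delta>\<^sup>2))"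
proof -
  have "(\<Sum>i<n. \<Sum>j<m. sqrt ((C $$ (i, j))\<^sup>2 * (V $$ (i, j))\<^sup>2 + \<delta>\<^sup>2)
         + reweighted C (weight \<delta> C V) V $$ (i, j) * Q $$ (i, j))
     \<le> (\<Sum>i<n. \<Sum>j<m. sqrt ((C $$ (i, j))\<^sup>2 * ((V + Q) $$ (i, j))\<^sup>2 + \<delta>\<^sup>2))"
    using assms sqrt_above_tangent[OF \<open>0 < \<delta>\<close>]
    by (intro sum_mono) (simp add: reweighted_entry[where n = n and m = m] weight_entry)
  then show ?thesis
    using assms by (simp add: frob_inner_eq[where n = n and m = m] sum.distrib)
qed

lemma fidelity_expansion:
  assumes "A \<in> carrier_mat n m" "E \<in> carrier_mat n m"
  shows "1 / (2 * \<tau>) * (frob (A + E))\<^sup>2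
       = 1 / (2 * \<tau>) * (frob A)\<^sup>2 + 1 / \<tau> * frob_inner A E + 1 / (2 * \<tau>) * (frob E)\<^sup>2"
  by (simp add: frob_square_add[OF assms] algebra_simps add_divide_distrib)

locale irls_problem =
  fixes N M :: nat and \<tau> \<delta> :: real and Cv Ch Gv Gh :: "real mat"
  assumes tau_pos: "0 < \<tau>" and delta_pos: "0 < \<delta>"
    and Cv [simp]: "Cv \<in> carrier_mat (N - 1) M" and Ch [simp]: "Ch \<in> carrier_mat N (M - 1)"
    and Gv [simp]: "Gv \<in> carrier_mat (N - 1) M" and Gh [simp]: "Gh \<in> carrier_mat N (M - 1)"
    and Cv_pos: "\<And>i j. i < N - 1 \<Longrightarrow> j < M \<Longrightarrow> 0 < Cv $$ (i, j)"
    and Ch_pos: "\<And>i j. i < N \<Longrightarrow> j < M - 1 \<Longrightarrow> 0 < Ch $$ (i, j)"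
begin

abbreviation F where "F \<equiv> F_fun N M \<tau> \<delta> Cv Ch Gv Gh"
abbreviation H where "H \<equiv> H_fun N M \<tau> \<delta> Cv Ch Gv Gh"

abbreviation res_v where "res_v U Vv \<equiv> S_mat N * U - Gv - Vv"
abbreviation res_h where "res_h U Vh \<equiv> U * T_mat M - Gh - Vh"

definition grad_U where
  "grad_U U Vv Vh =
     1 / \<tau> \<cdot>\<^sub>m (transpose_mat (S_mat N) * res_v U Vv + res_h U Vh * transpose_mat (T_mat M))"

definition grad_Vv where
  "grad_Vv U Vv Wv = reweighted Cv Wv Vv + 1 / \<tau> \<cdot>\<^sub>m (Vv - S_mat N * U + Gv)"

definition grad_Vh where
  "grad_Vh U Vh Wh = reweighted Ch Wh Vh + 1 / \<tau> \<cdot>\<^sub>m (Vh - U * T_mat M + Gh)"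

definition slope where
  "slope U Vv Vh Wv Wh P Qv Qh =
     frob_inner (grad_U U Vv Vh) P + frob_inner (grad_Vv U Vv Wv) Qv
     + frob_inner (grad_Vh U Vh Wh) Qh"

definition grad_norm where
  "grad_norm U Vv Vh Wv Wh =
     sqrt ((frob (grad_U U Vv Vh))\<^sup>2 + (frob (grad_Vv U Vv Wv))\<^sup>2 + (frob (grad_Vh U Vh Wh))\<^sup>2)"

lemmas data_dim [simp] =
  carrier_matD[OF Cv] carrier_matD[OF Ch] carrier_matD[OF Gv] carrier_matD[OF Gh]

lemma prod_carrier [simp]:
  "U \<in> carrier_mat N M \<Longrightarrow> S_mat N * U \<in> carrier_mat (N - 1) M"
  "U \<in> carrier_mat N M \<Longrightarrow> U * T_mat M \<in> carrier_mat N (M - 1)"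
  by (rule mult_carrier_mat[OF S_mat_carrier] mult_carrier_mat[OF _ T_mat_carrier], assumption)+

lemma grad_carrier:
  assumes "U \<in> carrier_mat N M" "Vv \<in> carrier_mat (N - 1) M" "Vh \<in> carrier_mat N (M - 1)"
  shows "grad_U U Vv Vh \<in> carrier_mat N M" "grad_Vv U Vv Wv \<in> carrier_mat (N - 1) M"
    "grad_Vh U Vh Wh \<in> carrier_mat N (M - 1)"
  using assms unfolding grad_U_def grad_Vv_def grad_Vh_def
  by (auto intro!: smult_carrier_mat add_carrier_mat mult_carrier_mat minus_carrier_mat)

lemma res_add:
  assumes "U \<in> carrier_mat N M" "P \<in> carrier_mat N M"
  shows "Vv \<in> carrier_mat (N - 1) M \<Longrightarrow> Q \<in> carrier_mat (N - 1) M \<Longrightarrow>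
           res_v (U + P) (Vv + Q) = res_v U Vv + (S_mat N * P - Q)"
    and "Vh \<in> carrier_mat N (M - 1) \<Longrightarrow> Q' \<in> carrier_mat N (M - 1) \<Longrightarrow>
           res_h (U + P) (Vh + Q') = res_h U Vh + (P * T_mat M - Q')"
  using mult_add_distrib_mat[OF S_mat_carrier assms] add_mult_distrib_mat[OF assms T_mat_carrier]
    prod_carrier[OF assms(1)] prod_carrier[OF assms(2)]
  by (auto intro!: eq_matI simp del: index_mult_mat(1))

text \<open>
  In this form the slope is visibly the first-order change along \<open>(P, Qv, Qh)\<close>, since the residuals
  change by \<open>S P - Qv\<close> and \<open>P T - Qh\<close>.
\<close>

lemma slope_eq:
  assumes "U \<in> carrier_mat N M" "Vv \<in> carrier_mat (N - 1) M" "Vh \<in> carrier_mat N (M - 1)"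
    and "P \<in> carrier_mat N M" "Qv \<in> carrier_mat (N - 1) M" "Qh \<in> carrier_mat N (M - 1)"
  shows "slope U Vv Vh Wv Wh P Qv Qh
    = frob_inner (reweighted Cv Wv Vv) Qv + frob_inner (reweighted Ch Wh Vh) Qh
      + 1 / \<tau> * frob_inner (res_v U Vv) (S_mat N * P - Qv)
      + 1 / \<tau> * frob_inner (res_h U Vh) (P * T_mat M - Qh)"
proof -
  have rc: "res_v U Vv \<in> carrier_mat (N - 1) M" "res_h U Vh \<in> carrier_mat N (M - 1)"
    using assms by auto
  have "Vv - S_mat N * U + Gv = (- 1) \<cdot>\<^sub>m res_v U Vv"
    using assms prod_carrier[OF assms(1)] by (intro eq_matI) (auto simp del: index_mult_mat(1))
  then have v: "grad_Vv U Vv Wv = reweighted Cv Wv Vv + 1 / \<tau> \<cdot>\<^sub>m ((- 1) \<cdot>\<^sub>m res_v U Vv)"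
    by (simp add: grad_Vv_def)
  have "Vh - U * T_mat M + Gh = (- 1) \<cdot>\<^sub>m res_h U Vh"
    using assms prod_carrier[OF assms(1)] by (intro eq_matI) (auto simp del: index_mult_mat(1))
  then have h: "grad_Vh U Vh Wh = reweighted Ch Wh Vh + 1 / \<tau> \<cdot>\<^sub>m ((- 1) \<cdot>\<^sub>m res_h U Vh)"
    by (simp add: grad_Vh_def)
  have "frob_inner (grad_U U Vv Vh) P
      = 1 / \<tau> * (frob_inner (res_v U Vv) (S_mat N * P) + frob_inner (res_h U Vh) (P * T_mat M))"
  proof -
    have c: "transpose_mat (S_mat N) * res_v U Vv \<in> carrier_mat N M"
      "res_h U Vh * transpose_mat (T_mat M) \<in> carrier_mat N M"
      using rc by (auto intro!: mult_carrier_mat)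
    then show ?thesis
      using frob_inner_transpose_mult[OF S_mat_carrier rc(1) assms(4)]
        frob_inner_mult_transpose[OF T_mat_carrier rc(2) assms(4)]
      by (simp add: grad_U_def frob_inner_scale_left[where n = N and m = M]
          frob_inner_add_left[OF c])
  qed
  moreover have "frob_inner (grad_Vv U Vv Wv) Qv
      = frob_inner (reweighted Cv Wv Vv) Qv - 1 / \<tau> * frob_inner (res_v U Vv) Qv"
    using rc(1) unfolding v
    by (subst frob_inner_add_left[where n = "N - 1" and m = M])
       (auto simp: frob_inner_scale_left[where n = "N - 1" and m = M])
  moreover have "frob_inner (grad_Vh U Vh Wh) Qh
      = frob_inner (reweighted Ch Wh Vh) Qh - 1 / \<tau> * frob_inner (res_h U Vh) Qh"
    using rc(2) unfolding h
    by (subst frob_inner_add_left[where n = N and m = "M - 1"])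
       (auto simp: frob_inner_scale_left[where n = N and m = "M - 1"])
  ultimately show ?thesis
    using frob_inner_diff_right[OF rc(1) prod_carrier(1)[OF assms(4)] assms(5)]
      frob_inner_diff_right[OF rc(2) prod_carrier(2)[OF assms(4)] assms(6)]
    by (simp add: slope_def ring_distribs diff_divide_distrib)
qed

text \<open>For fixed weights \<open>H\<close> is quadratic, so its second-order Taylor expansion is exact.\<close>

lemma H_expansion:
  assumes "U \<in> carrier_mat N M" "Vv \<in> carrier_mat (N - 1) M" "Vh \<in> carrier_mat N (M - 1)"
    and "Wv \<in> carrier_mat (N - 1) M" "Wh \<in> carrier_mat N (M - 1)"
    and "P \<in> carrier_mat N M" "Qv \<in> carrier_mat (N - 1) M" "Qh \<in> carrier_mat N (M - 1)"
  shows "H (U + P, Vv + Qv, Vh + Qh, Wv, Wh) = H (U, Vv, Vh, Wv, Wh) + slope U Vv Vh Wv Wh P Qv Qh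
    + 1 / 2 * (\<Sum>i<N - 1. \<Sum>j<M. (Cv $$ (i, j))\<^sup>2 / Wv $$ (i, j) * (Qv $$ (i, j))\<^sup>2)
    + 1 / 2 * (\<Sum>i<N. \<Sum>j<M - 1. (Ch $$ (i, j))\<^sup>2 / Wh $$ (i, j) * (Qh $$ (i, j))\<^sup>2)
    + 1 / (2 * \<tau>) * (frob (S_mat N * P - Qv))\<^sup>2 + 1 / (2 * \<tau>) * (frob (P * T_mat M - Qh))\<^sup>2"
proof -
  have r: "res_v U Vv \<in> carrier_mat (N - 1) M" "res_h U Vh \<in> carrier_mat N (M - 1)"
    "S_mat N * P - Qv \<in> carrier_mat (N - 1) M" "P * T_mat M - Qh \<in> carrier_mat N (M - 1)"
    using assms by auto
  show ?thesis
    unfolding H_fun.simps res_add(1)[OF assms(1,6,2,7)] res_add(2)[OF assms(1,6,3,8)]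
      slope_eq[OF assms(1-3,6-8)] fidelity_expansion[OF r(1,3)] fidelity_expansion[OF r(2,4)]
      majorizer_expansion[OF Cv assms(4,2,7)] majorizer_expansion[OF Ch assms(5,3,8)]
    by simp
qed

text \<open>
  The candidate is \<open>X - g / L\<close>.  The exact expansion gives \<open>H X - |g|\<^sup>2 / L\<close> plus half the curvature in
  direction \<open>g / L\<close>, and the curvature is at most \<open>L |g / L|\<^sup>2\<close> once the weights are at least \<open>\<delta>\<close>.
\<close>

lemma H_descent:
  assumes "U \<in> carrier_mat N M" "Vv \<in> carrier_mat (N - 1) M" "Vh \<in> carrier_mat N (M - 1)"
    and "Wv \<in> carrier_mat (N - 1) M" "Wh \<in> carrier_mat N (M - 1)"
    and Wv: "\<And>i j. i < N - 1 \<Longrightarrow> j < M \<Longrightarrow> \<delta> \<le> Wv $$ (i, j)"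
    and Wh: "\<And>i j. i < N \<Longrightarrow> j < M - 1 \<Longrightarrow> \<delta> \<le> Wh $$ (i, j)"
    and L: "L = 12 / \<tau> + 1 / \<delta> * (C_max Cv Ch)\<^sup>2"
  shows "H (candidate N M \<tau> L Cv Ch Gv Gh (U, Vv, Vh, Wv, Wh))
     \<le> H (U, Vv, Vh, Wv, Wh) - (grad_norm U Vv Vh Wv Wh)\<^sup>2 / (2 * L)"
proof -
  let ?gU = "grad_U U Vv Vh" and ?gv = "grad_Vv U Vv Wv" and ?gh = "grad_Vh U Vh Wh"
  let ?c = "C_max Cv Ch"
  have L0: "0 < L" using tau_pos delta_pos unfolding L by (intro add_pos_nonneg) auto
  note g = grad_carrier[OF assms(1-3)]
  define P Qv Qh where "P = (- 1 / L) \<cdot>\<^sub>m ?gU" and "Qv = (- 1 / L) \<cdot>\<^sub>m ?gv" and "Qh = (- 1 / L) \<cdot>\<^sub>m ?gh"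
  have c: "P \<in> carrier_mat N M" "Qv \<in> carrier_mat (N - 1) M" "Qh \<in> carrier_mat N (M - 1)"
    using g by (simp_all add: P_def Qv_def Qh_def)
  have cand: "candidate N M \<tau> L Cv Ch Gv Gh (U, Vv, Vh, Wv, Wh) = (U + P, Vv + Qv, Vh + Qh, Wv, Wh)"
  proof -
    have X: "transpose_mat (S_mat N) * res_v U Vv + res_h U Vh * transpose_mat (T_mat M) \<in> carrier_mat N M"
      using assms by (auto intro!: mult_carrier_mat add_carrier_mat)
    have "U - 1 / (\<tau> * L) \<cdot>\<^sub>m (transpose_mat (S_mat N) * res_v U Vv + res_h U Vh * transpose_mat (T_mat M)) = U + P"
      using X assms(1) unfolding P_def grad_U_def
      by (intro eq_matI) (auto simp del: index_mult_mat(1) simp: field_simps)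
    moreover have "Vv - 1 / L \<cdot>\<^sub>m ?gv = Vv + Qv" "Vh - 1 / L \<cdot>\<^sub>m ?gh = Vh + Qh"
      using g assms(2,3) unfolding Qv_def Qh_def by (auto intro!: eq_matI)
    ultimately show ?thesis
      by (simp add: grad_Vv_def grad_Vh_def reweighted_def)
  qed
  have Cvc: "0 \<le> Cv $$ (i, j) \<and> Cv $$ (i, j) \<le> ?c" if "i < N - 1" "j < M" for i j
  proof -
    have "Cv $$ (i, j) \<le> Max (elements_mat Cv)"
      using that by (intro Max_ge elements_matI[OF Cv]) (auto simp: elements_mat_def)
    then show ?thesis using Cv_pos[OF that] by (simp add: C_max_def)
  qed
  have Chc: "0 \<le> Ch $$ (i, j) \<and> Ch $$ (i, j) \<le> ?c" if "i < N" "j < M - 1" for i j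
  proof -
    have "Ch $$ (i, j) \<le> Max (elements_mat Ch)"
      using that by (intro Max_ge elements_matI[OF Ch]) (auto simp: elements_mat_def)
    then show ?thesis using Ch_pos[OF that] by (simp add: C_max_def)
  qed
  define n where "n = (frob P)\<^sup>2 + (frob Qv)\<^sup>2 + (frob Qh)\<^sup>2"
  have n: "n = (grad_norm U Vv Vh Wv Wh)\<^sup>2 / L\<^sup>2"
    by (simp add: n_def grad_norm_def P_def Qv_def Qh_def frob_square_scale power_divide algebra_simps
        add_divide_distrib)
  have s: "slope U Vv Vh Wv Wh P Qv Qh = - (grad_norm U Vv Vh Wv Wh)\<^sup>2 / L"
    using g by (simp add: slope_def P_def Qv_def Qh_def frob_inner_scale[OF g(1) g(1)]
        frob_inner_scale[OF g(2) g(2)] frob_inner_scale[OF g(3) g(3)] frob_inner_self grad_norm_def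
        add_divide_distrib diff_divide_distrib)
  have "(\<Sum>i<N - 1. \<Sum>j<M. (Cv $$ (i, j))\<^sup>2 / Wv $$ (i, j) * (Qv $$ (i, j))\<^sup>2)
      + (\<Sum>i<N. \<Sum>j<M - 1. (Ch $$ (i, j))\<^sup>2 / Wh $$ (i, j) * (Qh $$ (i, j))\<^sup>2)
      \<le> 1 / \<delta> * ?c\<^sup>2 * ((frob Qv)\<^sup>2 + (frob Qh)\<^sup>2)"
    using majorizer_curvature_le[OF Cv c(2) delta_pos Cvc Wv]
      majorizer_curvature_le[OF Ch c(3) delta_pos Chc Wh] by (simp add: ring_distribs)
  also have "\<dots> \<le> 1 / \<delta> * ?c\<^sup>2 * n"
    using delta_pos by (intro mult_left_mono) (auto simp: n_def)
  finally have b1: "(\<Sum>i<N - 1. \<Sum>j<M. (Cv $$ (i, j))\<^sup>2 / Wv $$ (i, j) * (Qv $$ (i, j))\<^sup>2)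
      + (\<Sum>i<N. \<Sum>j<M - 1. (Ch $$ (i, j))\<^sup>2 / Wh $$ (i, j) * (Qh $$ (i, j))\<^sup>2) \<le> 1 / \<delta> * ?c\<^sup>2 * n" .
  have "(frob (S_mat N * P - Qv))\<^sup>2 + (frob (P * T_mat M - Qh))\<^sup>2 \<le> 12 * n"
    using frob_square_S_mat_diff_le[OF c(1,2)] frob_square_T_mat_diff_le[OF c(1,3)]
    by (simp add: n_def) (smt (verit) zero_le_power2)
  then have "1 / (2 * \<tau>) * ((frob (S_mat N * P - Qv))\<^sup>2 + (frob (P * T_mat M - Qh))\<^sup>2) \<le> 1 / (2 * \<tau>) * (12 * n)"
    using tau_pos by (intro mult_left_mono) auto
  then have b2: "1 / (2 * \<tau>) * (frob (S_mat N * P - Qv))\<^sup>2 + 1 / (2 * \<tau>) * (frob (P * T_mat M - Qh))\<^sup>2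
      \<le> 1 / 2 * (12 / \<tau> * n)"
    by (simp add: ring_distribs)
  have "H (U + P, Vv + Qv, Vh + Qh, Wv, Wh)
      \<le> H (U, Vv, Vh, Wv, Wh) - (grad_norm U Vv Vh Wv Wh)\<^sup>2 / L + 1 / 2 * (L * n)"
    using b1 b2 unfolding H_expansion[OF assms(1-5) c] s L by (simp add: ring_distribs)
  also have "\<dots> = H (U, Vv, Vh, Wv, Wh) - (grad_norm U Vv Vh Wv Wh)\<^sup>2 / (2 * L)"
    using L0 by (simp add: n power2_eq_square)
  finally show ?thesis unfolding cand .
qed

text \<open>
  Convexity of \<open>F\<close>, with its gradient expressed through that of \<open>H\<close> at the weights of the current point.
  This identification lets the descent of \<open>H\<close> be measured against the optimality gap of \<open>F\<close>.
\<close>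

lemma F_above_tangent:
  assumes "U \<in> carrier_mat N M" "Vv \<in> carrier_mat (N - 1) M" "Vh \<in> carrier_mat N (M - 1)"
    and "P \<in> carrier_mat N M" "Qv \<in> carrier_mat (N - 1) M" "Qh \<in> carrier_mat N (M - 1)"
  shows "F (U, Vv, Vh) + slope U Vv Vh (weight \<delta> Cv Vv) (weight \<delta> Ch Vh) P Qv Qh
       \<le> F (U + P, Vv + Qv, Vh + Qh)"
proof -
  have r: "res_v U Vv \<in> carrier_mat (N - 1) M" "res_h U Vh \<in> carrier_mat N (M - 1)"
    "S_mat N * P - Qv \<in> carrier_mat (N - 1) M" "P * T_mat M - Qh \<in> carrier_mat N (M - 1)"
    using assms by auto
  have p: "0 \<le> 1 / (2 * \<tau>) * x\<^sup>2" for x using tau_pos by simp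
  show ?thesis
    unfolding F_fun.simps res_add(1)[OF assms(1,4,2,5)] res_add(2)[OF assms(1,4,3,6)]
      slope_eq[OF assms] fidelity_expansion[OF r(1,3)] fidelity_expansion[OF r(2,4)]
    using smoothed_above_tangent[OF Cv assms(2,5) delta_pos]
      smoothed_above_tangent[OF Ch assms(3,6) delta_pos]
      p[of "frob (S_mat N * P - Qv)"] p[of "frob (P * T_mat M - Qh)"]
    by linarith
qed

lemma H_with_weights: "H (with_weights \<delta> Cv Ch X) = F X"
proof (cases X)
  case (fields U Vv Vh)
  then show ?thesis
    by (simp only: with_weights.simps H_fun.simps F_fun.simps majorizer_at_weight[OF Cv delta_pos]
        majorizer_at_weight[OF Ch delta_pos])
qed

lemma F_le_H:
  assumes "\<And>i j. i < N - 1 \<Longrightarrow> j < M \<Longrightarrow> 0 < Wv $$ (i, j)"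
    and "\<And>i j. i < N \<Longrightarrow> j < M - 1 \<Longrightarrow> 0 < Wh $$ (i, j)"
  shows "F (U, Vv, Vh) \<le> H (U, Vv, Vh, Wv, Wh)"
  using majorizer_ge[OF assms(1), of "N - 1" M Cv Vv \<delta>] majorizer_ge[OF assms(2), of N "M - 1" Ch Vh \<delta>]
  unfolding H_fun.simps F_fun.simps by linarith

end

section \<open>Compactness of sublevel sets\<close>

lemma double_sum_member_le:
  fixes f :: "nat \<Rightarrow> nat \<Rightarrow> real"
  assumes "\<And>i j. i < n \<Longrightarrow> j < m \<Longrightarrow> 0 \<le> f i j" "i < n" "j < m"
  shows "f i j \<le> (\<Sum>i<n. \<Sum>j<m. f i j)"
proof -
  have "f i j \<le> (\<Sum>j<m. f i j)"
    using assms by (intro member_le_sum) auto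
  also have "\<dots> \<le> (\<Sum>i<n. \<Sum>j<m. f i j)"
    using assms by (intro member_le_sum[of i "{..<n}" "\<lambda>i. \<Sum>j<m. f i j"]) (auto intro!: sum_nonneg)
  finally show ?thesis .
qed

lemma double_index_bounded:
  fixes f :: "nat \<Rightarrow> nat \<Rightarrow> real"
  obtains B where "0 \<le> B" "\<And>i j. i < n \<Longrightarrow> j < m \<Longrightarrow> f i j \<le> B"
proof
  show "0 \<le> (\<Sum>i<n. \<Sum>j<m. \<bar>f i j\<bar>)" by (simp add: sum_nonneg)
  show "f i j \<le> (\<Sum>i<n. \<Sum>j<m. \<bar>f i j\<bar>)" if "i < n" "j < m" for i j
    using double_sum_member_le[of n m "\<lambda>i j. \<bar>f i j\<bar>" i j] that by simp
qed

text \<open>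
  Each summand of the majorizer is at most \<open>2 c\<close>.  Its second part bounds the weight; then the first
  part bounds \<open>C\<^sup>2 V\<^sup>2\<close> by \<open>2 c\<close> times the weight.
\<close>

lemma majorizer_sublevel_entry_bound:
  fixes C V W :: "real mat"
  assumes "0 < \<delta>" and C: "\<And>i j. i < n \<Longrightarrow> j < m \<Longrightarrow> 0 < C $$ (i, j)"
    and W: "\<And>i j. i < n \<Longrightarrow> j < m \<Longrightarrow> \<delta> / 2 \<le> W $$ (i, j)"
    and c: "1 / 2 * (\<Sum>i<n. \<Sum>j<m.
        ((C $$ (i, j))\<^sup>2 * (V $$ (i, j))\<^sup>2 + \<delta>\<^sup>2) / W $$ (i, j) + W $$ (i, j)) \<le> c"
    and ij: "i < n" "j < m"
  shows "W $$ (i, j) \<le> 2 * c" "\<bar>V $$ (i, j)\<bar> \<le> 2 * c / C $$ (i, j)"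
proof -
  have W0: "0 < W $$ (i, j)" if "i < n" "j < m" for i j
    using W[OF that] \<open>0 < \<delta>\<close> by linarith
  have t: "((C $$ (i, j))\<^sup>2 * (V $$ (i, j))\<^sup>2 + \<delta>\<^sup>2) / W $$ (i, j) + W $$ (i, j) \<le> 2 * c"
    using double_sum_member_le[of n m "\<lambda>i j. ((C $$ (i, j))\<^sup>2 * (V $$ (i, j))\<^sup>2 + \<delta>\<^sup>2) / W $$ (i, j)
      + W $$ (i, j)", OF _ ij] W0 c by (fastforce simp: less_imp_le)
  moreover have "0 \<le> ((C $$ (i, j))\<^sup>2 * (V $$ (i, j))\<^sup>2 + \<delta>\<^sup>2) / W $$ (i, j)"
    using W0[OF ij] by simp
  ultimately show Wc: "W $$ (i, j) \<le> 2 * c" by linarith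
  have "((C $$ (i, j))\<^sup>2 * (V $$ (i, j))\<^sup>2 + \<delta>\<^sup>2) / W $$ (i, j) \<le> 2 * c"
    using t W0[OF ij] by linarith
  then have "(C $$ (i, j))\<^sup>2 * (V $$ (i, j))\<^sup>2 + \<delta>\<^sup>2 \<le> 2 * c * W $$ (i, j)"
    using W0[OF ij] by (simp add: divide_le_eq)
  also have "\<dots> \<le> 2 * c * (2 * c)"
    using Wc W0[OF ij] by (intro mult_left_mono) auto
  finally have "(C $$ (i, j))\<^sup>2 * (V $$ (i, j))\<^sup>2 \<le> (2 * c)\<^sup>2"
    using zero_le_power2[of \<delta>] unfolding power2_eq_square[of "2 * c"] by linarith
  then have "(C $$ (i, j) * \<bar>V $$ (i, j)\<bar>)\<^sup>2 \<le> (2 * c)\<^sup>2"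
    by (simp only: power_mult_distrib[of "C $$ (i, j)"] power2_abs)
  moreover have "0 \<le> 2 * c" using Wc W0[OF ij] by linarith
  ultimately have "C $$ (i, j) * \<bar>V $$ (i, j)\<bar> \<le> 2 * c"
    by (rule power2_le_imp_le)
  then show "\<bar>V $$ (i, j)\<bar> \<le> 2 * c / C $$ (i, j)"
    using C[OF ij] by (simp add: pos_le_divide_eq mult.commute)
qed

lemma frob_entry_le:
  assumes "A \<in> carrier_mat n m" "i < n" "j < m"
  shows "\<bar>A $$ (i, j)\<bar> \<le> frob A"
proof -
  have "(A $$ (i, j))\<^sup>2 \<le> (frob A)\<^sup>2"
    using double_sum_member_le[of n m "\<lambda>i j. (A $$ (i, j))\<^sup>2" i j] assms by (simp add: frob_square)
  then show ?thesis using frob_nonneg[of A] abs_le_square_iff[of "A $$ (i, j)" "frob A"] by simp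
qed

text \<open>
  Compactness is established for entry functions on all pairs of indices, in the product topology.  Entries outside the matrix range over the same interval, so that
  the box is a full product.
\<close>

definition entry_box :: "real \<Rightarrow> real \<Rightarrow> (nat \<times> nat \<Rightarrow> real) set" where
  "entry_box a b = (UNIV \<rightarrow> {a..b})"

lemma compact_entry_box: "compact (entry_box a b)"
proof -
  have "compactin (product_topology (\<lambda>_. euclidean) UNIV) (PiE UNIV (\<lambda>_::nat \<times> nat. {a..b}))"
    by (simp add: compactin_PiE)
  then show ?thesis
    by (simp add: euclidean_product_topology entry_box_def PiE_UNIV_domain)
qed

lemma closed_entry_box: "closed (entry_box a b)"
proof -
  have "entry_box a b = (\<Inter>p. {f. a \<le> f p} \<inter> {f. f p \<le> b})"
    by (auto simp: entry_box_def Pi_def)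
  moreover have "closed ({f. a \<le> f p} \<inter> {f. f p \<le> b})" for p :: "nat \<times> nat"
    by (intro closed_Int closed_Collect_le continuous_on_const continuous_on_product_coordinates)
  ultimately show ?thesis by auto
qed

lemma mat_from_entry_box:
  assumes "A \<in> carrier_mat n m" "a \<le> b"
    and "\<And>i j. i < n \<Longrightarrow> j < m \<Longrightarrow> a \<le> A $$ (i, j) \<and> A $$ (i, j) \<le> b"
  obtains f where "f \<in> entry_box a b" "A = mat n m f"
proof
  show "(\<lambda>(i, j). if i < n \<and> j < m then A $$ (i, j) else a) \<in> entry_box a b"
    using assms by (auto simp: entry_box_def)
  show "A = mat n m (\<lambda>(i, j). if i < n \<and> j < m then A $$ (i, j) else a)"
    using assms by (intro eq_matI) auto
qed

type_synonym entry_fun = "nat \<times> nat \<Rightarrow> real"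

definition to_mats :: "nat \<Rightarrow> nat \<Rightarrow> entry_fun \<times> entry_fun \<times> entry_fun \<times> entry_fun \<times> entry_fun \<Rightarrow> quintuple"
  where "to_mats N M = (\<lambda>(u, vv, vh, wv, wh). (mat N M u, mat (N - 1) M vv, mat N (M - 1) vh,
     mat (N - 1) M wv, mat N (M - 1) wh))"

lemma continuous_tuple_dist_to_mats:
  assumes "U' \<in> carrier_mat N M" "Vv' \<in> carrier_mat (N - 1) M" "Vh' \<in> carrier_mat N (M - 1)"
    "Wv' \<in> carrier_mat (N - 1) M" "Wh' \<in> carrier_mat N (M - 1)"
  shows "continuous_on Z (\<lambda>x. tuple_dist (to_mats N M x) (U', Vv', Vh', Wv', Wh'))"
proof -
  have d: "(frob (mat n m f - A))\<^sup>2 = (\<Sum>i<n. \<Sum>j<m. (f (i, j) - A $$ (i, j))\<^sup>2)"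
    if "A \<in> carrier_mat n m" for n m f A
    using that by (subst frob_square[of _ n m]) auto
  show ?thesis
    unfolding to_mats_def case_prod_unfold tuple_dist.simps
      d[OF assms(1)] d[OF assms(2)] d[OF assms(3)] d[OF assms(4)] d[OF assms(5)]
    by (intro continuous_intros continuous_on_product_then_coordinatewise)
qed

context irls_problem
begin

lemma continuous_H_to_mats:
  assumes "\<And>u vv vh wv wh p. (u, vv, vh, wv, wh) \<in> Z \<Longrightarrow> 0 < wv p \<and> 0 < wh p"
  shows "continuous_on Z (\<lambda>x. H (to_mats N M x))"
proof -
  have v: "(frob (res_v (mat N M u) (mat (N - 1) M vv)))\<^sup>2
      = (\<Sum>i<N - 1. \<Sum>j<M. (u (i + 1, j) - u (i, j) - Gv $$ (i, j) - vv (i, j))\<^sup>2)" for u vv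
    by (subst frob_square[of _ "N - 1" M])
      (auto intro!: sum.cong simp del: index_mult_mat(1) simp: S_mat_mult_entry[where N = N and M = M])
  have h: "(frob (res_h (mat N M u) (mat N (M - 1) vh)))\<^sup>2
      = (\<Sum>i<N. \<Sum>j<M - 1. (u (i, j + 1) - u (i, j) - Gh $$ (i, j) - vh (i, j))\<^sup>2)" for u vh
    by (subst frob_square[of _ N "M - 1"])
      (auto intro!: sum.cong simp del: index_mult_mat(1) simp: mult_T_mat_entry[where N = N and M = M])
  have m: "(\<Sum>i<n. \<Sum>j<m. ((C $$ (i, j))\<^sup>2 * (mat n m f $$ (i, j))\<^sup>2 + \<delta>\<^sup>2) / mat n m w $$ (i, j) + mat n m w $$ (i, j))
     = (\<Sum>i<n. \<Sum>j<m. ((C $$ (i, j))\<^sup>2 * (f (i, j))\<^sup>2 + \<delta>\<^sup>2) / w (i, j) + w (i, j))" for C n m f w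
    by simp
  have nz: "fst (snd (snd (snd x))) p \<noteq> 0" "snd (snd (snd (snd x))) p \<noteq> 0" if "x \<in> Z" for x p
    using assms[of "fst x" "fst (snd x)" "fst (snd (snd x))" "fst (snd (snd (snd x)))" "snd (snd (snd (snd x)))" p] that
    by auto
  show ?thesis
    unfolding to_mats_def case_prod_unfold H_fun.simps v h m
    by (intro continuous_intros continuous_on_product_then_coordinatewise ballI nz)
qed

text \<open>
  The bounds are obtained in the order \<open>W\<close>, \<open>V\<close>, \<open>U\<close>: the fidelity terms bound the residuals, hence,
  with \<open>V\<close> and \<open>G\<close> bounded, the differences of \<open>U\<close>, hence \<open>U\<close> by \<open>mean_zero_entry_bound\<close>.
\<close>

lemma sublevel_entry_bound:
  obtains b where "\<delta> / 2 \<le> b"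
    and "\<And>U Vv Vh Wv Wh i j. (U, Vv, Vh, Wv, Wh) \<in> Gam N M \<delta> \<Longrightarrow> H (U, Vv, Vh, Wv, Wh) \<le> c \<Longrightarrow>
      (i < N \<and> j < M \<longrightarrow> \<bar>U $$ (i, j)\<bar> \<le> b)
      \<and> (i < N - 1 \<and> j < M \<longrightarrow> \<bar>Vv $$ (i, j)\<bar> \<le> b \<and> Wv $$ (i, j) \<le> b)
      \<and> (i < N \<and> j < M - 1 \<longrightarrow> \<bar>Vh $$ (i, j)\<bar> \<le> b \<and> Wh $$ (i, j) \<le> b)"
proof -
  obtain Bv where Bv: "0 \<le> Bv" "\<And>i j. i < N - 1 \<Longrightarrow> j < M \<Longrightarrow> 2 * c / Cv $$ (i, j) \<le> Bv"
    by (rule double_index_bounded[of "N - 1" M "\<lambda>i j. 2 * c / Cv $$ (i, j)"]) blast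
  obtain Bh where Bh: "0 \<le> Bh" "\<And>i j. i < N \<Longrightarrow> j < M - 1 \<Longrightarrow> 2 * c / Ch $$ (i, j) \<le> Bh"
    by (rule double_index_bounded[of N "M - 1" "\<lambda>i j. 2 * c / Ch $$ (i, j)"]) blast
  define D where "D = \<bar>sqrt (2 * \<tau> * c)\<bar> + frob Gv + frob Gh + Bv + Bh"
  define b where "b = \<bar>2 * c\<bar> + \<delta> + Bv + Bh + 2 * (real N + real M) * D"
  have D0: "0 \<le> D" using Bv(1) Bh(1) by (simp add: D_def frob_nonneg)
  have ND: "0 \<le> 2 * (real N + real M) * D" using D0 by simp
  show thesis
  proof (rule that[of b])
    show "\<delta> / 2 \<le> b" using ND delta_pos Bv(1) Bh(1) by (simp add: b_def)
    fix U Vv Vh Wv Wh i j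
    assume G: "(U, Vv, Vh, Wv, Wh) \<in> Gam N M \<delta>" and Hc: "H (U, Vv, Vh, Wv, Wh) \<le> c"
    have car: "U \<in> carrier_mat N M" "Vv \<in> carrier_mat (N - 1) M" "Vh \<in> carrier_mat N (M - 1)"
      and Wv: "\<And>i j. i < N - 1 \<Longrightarrow> j < M \<Longrightarrow> \<delta> / 2 \<le> Wv $$ (i, j)"
      and Wh: "\<And>i j. i < N \<Longrightarrow> j < M - 1 \<Longrightarrow> \<delta> / 2 \<le> Wh $$ (i, j)"
      and U0: "U \<in> C0 N M"
      using G by (auto simp: Gam_def C0_def)
    let ?mv = "1 / 2 * (\<Sum>i<N - 1. \<Sum>j<M.
        ((Cv $$ (i, j))\<^sup>2 * (Vv $$ (i, j))\<^sup>2 + \<delta>\<^sup>2) / Wv $$ (i, j) + Wv $$ (i, j))"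
    let ?mh = "1 / 2 * (\<Sum>i<N. \<Sum>j<M - 1.
        ((Ch $$ (i, j))\<^sup>2 * (Vh $$ (i, j))\<^sup>2 + \<delta>\<^sup>2) / Wh $$ (i, j) + Wh $$ (i, j))"
    have Wv0: "0 \<le> Wv $$ (i, j)" if "i < N - 1" "j < M" for i j
      using Wv[OF that] delta_pos by linarith
    have Wh0: "0 \<le> Wh $$ (i, j)" if "i < N" "j < M - 1" for i j
      using Wh[OF that] delta_pos by linarith
    have nn: "0 \<le> ?mv" "0 \<le> ?mh"
      using Wv0 Wh0 by (auto intro!: sum_nonneg add_nonneg_nonneg divide_nonneg_nonneg)
    have fid: "0 \<le> 1 / (2 * \<tau>) * x\<^sup>2" for x using tau_pos by simp
    have parts: "?mv \<le> c" "?mh \<le> c" "1 / (2 * \<tau>) * (frob (res_v U Vv))\<^sup>2 \<le> c"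
      "1 / (2 * \<tau>) * (frob (res_h U Vh))\<^sup>2 \<le> c"
      using Hc nn fid[of "frob (res_v U Vv)"] fid[of "frob (res_h U Vh)"]
      unfolding H_fun.simps by linarith+
    have rb: "x \<le> \<bar>sqrt (2 * \<tau> * c)\<bar>" if "1 / (2 * \<tau>) * x\<^sup>2 \<le> c" for x
    proof -
      have "x\<^sup>2 \<le> 2 * \<tau> * c" using that tau_pos by (simp add: field_simps)
      then have "x \<le> sqrt (2 * \<tau> * c)" by (rule real_le_rsqrt)
      then show ?thesis by linarith
    qed
    have vb: "\<bar>Vv $$ (i, j)\<bar> \<le> Bv" "Wv $$ (i, j) \<le> 2 * c" if "i < N - 1" "j < M" for i j
      using majorizer_sublevel_entry_bound[OF delta_pos Cv_pos Wv parts(1) that] Bv(2)[OF that]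
      by linarith+
    have hb: "\<bar>Vh $$ (i, j)\<bar> \<le> Bh" "Wh $$ (i, j) \<le> 2 * c" if "i < N" "j < M - 1" for i j
      using majorizer_sublevel_entry_bound[OF delta_pos Ch_pos Wh parts(2) that] Bh(2)[OF that]
      by linarith+
    have Sb: "\<bar>(S_mat N * U) $$ (i, j)\<bar> \<le> D" if "i < N - 1" "j < M" for i j
    proof -
      have r: "res_v U Vv \<in> carrier_mat (N - 1) M" using car by auto
      have "res_v U Vv $$ (i, j) = (S_mat N * U) $$ (i, j) - Gv $$ (i, j) - Vv $$ (i, j)"
        using car that by (simp del: index_mult_mat(1))
      then show ?thesis
        using frob_entry_le[OF r that] frob_entry_le[OF Gv that] vb(1)[OF that] rb[OF parts(3)]
          frob_nonneg[of Gh] Bh(1) by (simp add: D_def)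
    qed
    have Tb: "\<bar>(U * T_mat M) $$ (i, j)\<bar> \<le> D" if "i < N" "j < M - 1" for i j
    proof -
      have r: "res_h U Vh \<in> carrier_mat N (M - 1)" using car by auto
      have "res_h U Vh $$ (i, j) = (U * T_mat M) $$ (i, j) - Gh $$ (i, j) - Vh $$ (i, j)"
        using car that by (simp del: index_mult_mat(1))
      then show ?thesis
        using frob_entry_le[OF r that] frob_entry_le[OF Gh that] hb(1)[OF that] rb[OF parts(4)]
          frob_nonneg[of Gv] Bv(1) by (simp add: D_def)
    qed
    have Ub: "\<bar>U $$ (i, j)\<bar> \<le> 2 * (real N + real M) * D" if "i < N" "j < M" for i j
      using mean_zero_entry_bound[OF U0 D0 Sb Tb that] .
    show "(i < N \<and> j < M \<longrightarrow> \<bar>U $$ (i, j)\<bar> \<le> b)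
      \<and> (i < N - 1 \<and> j < M \<longrightarrow> \<bar>Vv $$ (i, j)\<bar> \<le> b \<and> Wv $$ (i, j) \<le> b)
      \<and> (i < N \<and> j < M - 1 \<longrightarrow> \<bar>Vh $$ (i, j)\<bar> \<le> b \<and> Wh $$ (i, j) \<le> b)"
    proof -
      have le_b: "2 * (real N + real M) * D \<le> b" "Bv \<le> b" "Bh \<le> b" "2 * c \<le> b"
        using Bv(1) Bh(1) ND delta_pos unfolding b_def by linarith+
      have "\<bar>U $$ (i, j)\<bar> \<le> b" if "i < N" "j < M"
        using Ub[OF that] le_b by linarith
      moreover have "\<bar>Vv $$ (i, j)\<bar> \<le> b" "Wv $$ (i, j) \<le> b" if "i < N - 1" "j < M"
        using vb[OF that] le_b by linarith+
      moreover have "\<bar>Vh $$ (i, j)\<bar> \<le> b" "Wh $$ (i, j) \<le> b" if "i < N" "j < M - 1"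
        using hb[OF that] le_b by linarith+
      ultimately show ?thesis by blast
    qed
  qed
qed

text \<open>
  Serves as compactness of a sublevel set of matrix tuples: a function on matrices that is continuous in
  the entries attains its extrema on the sublevel set.  Putting the lower bound \<open>\<delta> / 2\<close> on the weights
  into the box keeps the division in \<open>H\<close> continuous.
\<close>

lemma sublevel_compact_image:
  obtains Z where "compact Z" "to_mats N M ` Z = {Y \<in> Gam N M \<delta>. H Y \<le> c}"
    "continuous_on Z (\<lambda>x. H (to_mats N M x))"
proof -
  obtain b where b: "\<delta> / 2 \<le> b"
    and bd: "\<And>U Vv Vh Wv Wh i j. (U, Vv, Vh, Wv, Wh) \<in> Gam N M \<delta> \<Longrightarrow> H (U, Vv, Vh, Wv, Wh) \<le> c \<Longrightarrow>
      (i < N \<and> j < M \<longrightarrow> \<bar>U $$ (i, j)\<bar> \<le> b)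
      \<and> (i < N - 1 \<and> j < M \<longrightarrow> \<bar>Vv $$ (i, j)\<bar> \<le> b \<and> Wv $$ (i, j) \<le> b)
      \<and> (i < N \<and> j < M - 1 \<longrightarrow> \<bar>Vh $$ (i, j)\<bar> \<le> b \<and> Wh $$ (i, j) \<le> b)"
    by (rule sublevel_entry_bound[of c]) blast
  have b0: "- b \<le> b" using b delta_pos by linarith
  define B where "B = entry_box (- b) b \<times> entry_box (- b) b \<times> entry_box (- b) b
    \<times> entry_box (\<delta> / 2) b \<times> entry_box (\<delta> / 2) b"
  define Z where "Z = B \<inter> {x. entry_sum (mat N M (fst x)) = 0} \<inter> {x \<in> B. H (to_mats N M x) \<le> c}"
  have cB: "compact B"
    unfolding B_def by (intro compact_Times compact_entry_box)
  have wpos: "0 < wv p \<and> 0 < wh p" if "(u, vv, vh, wv, wh) \<in> B" for u vv vh wv wh p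
  proof -
    have "wv p \<in> {\<delta> / 2..b}" "wh p \<in> {\<delta> / 2..b}"
      using that unfolding B_def entry_box_def by blast+
    then show ?thesis using delta_pos by auto
  qed
  have conB: "continuous_on B (\<lambda>x. H (to_mats N M x))"
    by (rule continuous_H_to_mats) (rule wpos)
  show thesis
  proof (rule that[of Z])
    have "closed {x \<in> B. H (to_mats N M x) \<le> c}"
      using cB conB by (intro continuous_on_closed_Collect_le continuous_on_const)
        (auto simp: B_def intro!: closed_Times closed_entry_box)
    moreover have "closed {x :: entry_fun \<times> entry_fun \<times> entry_fun \<times> entry_fun \<times> entry_fun.
        entry_sum (mat N M (fst x)) = 0}"
    proof -
      have "entry_sum (mat N M u) = (\<Sum>i<N. \<Sum>j<M. u (i, j))" for u
        by (simp add: entry_sum_def)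
      then show ?thesis
        by (simp only:) (intro closed_Collect_eq continuous_on_sum continuous_on_const
            continuous_on_product_then_coordinatewise[OF continuous_on_fst[OF continuous_on_id]])
    qed
    ultimately show "compact Z"
      unfolding Z_def using cB by (intro compact_Int_closed)
    show "continuous_on Z (\<lambda>x. H (to_mats N M x))"
      by (rule continuous_on_subset[OF conB]) (auto simp: Z_def)
    show "to_mats N M ` Z = {Y \<in> Gam N M \<delta>. H Y \<le> c}"
    proof (intro equalityI subsetI)
      fix Y assume "Y \<in> to_mats N M ` Z"
      then show "Y \<in> {Y \<in> Gam N M \<delta>. H Y \<le> c}"
        by (auto simp: Z_def B_def entry_box_def Pi_iff to_mats_def Gam_def C0_def simp del: H_fun.simps split_paired_All)
    next
      fix Y assume Y: "Y \<in> {Y \<in> Gam N M \<delta>. H Y \<le> c}"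
      obtain U Vv Vh Wv Wh where Ye: "Y = (U, Vv, Vh, Wv, Wh)" by (cases Y)
      have G: "(U, Vv, Vh, Wv, Wh) \<in> Gam N M \<delta>" and Hc: "H (U, Vv, Vh, Wv, Wh) \<le> c"
        using Y Ye by auto
      note bd' = bd[OF G Hc]
      have car: "U \<in> carrier_mat N M" "Vv \<in> carrier_mat (N - 1) M" "Vh \<in> carrier_mat N (M - 1)"
        "Wv \<in> carrier_mat (N - 1) M" "Wh \<in> carrier_mat N (M - 1)"
        and Wv: "\<And>i j. i < N - 1 \<Longrightarrow> j < M \<Longrightarrow> \<delta> / 2 \<le> Wv $$ (i, j)"
        and Wh: "\<And>i j. i < N \<Longrightarrow> j < M - 1 \<Longrightarrow> \<delta> / 2 \<le> Wh $$ (i, j)"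
        and U0: "entry_sum U = 0"
        using G by (auto simp: Gam_def C0_def)
      have Ub: "- b \<le> U $$ (i, j) \<and> U $$ (i, j) \<le> b" if "i < N" "j < M" for i j
        using bd'[of i j] that by (auto simp: abs_le_iff)
      have Vvb: "- b \<le> Vv $$ (i, j) \<and> Vv $$ (i, j) \<le> b" if "i < N - 1" "j < M" for i j
        using bd'[of i j] that by (auto simp: abs_le_iff)
      have Vhb: "- b \<le> Vh $$ (i, j) \<and> Vh $$ (i, j) \<le> b" if "i < N" "j < M - 1" for i j
        using bd'[of i j] that by (auto simp: abs_le_iff)
      have Wvb: "\<delta> / 2 \<le> Wv $$ (i, j) \<and> Wv $$ (i, j) \<le> b" if "i < N - 1" "j < M" for i j
        using bd'[of i j] Wv[OF that] that by blast
      have Whb: "\<delta> / 2 \<le> Wh $$ (i, j) \<and> Wh $$ (i, j) \<le> b" if "i < N" "j < M - 1" for i j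
        using bd'[of i j] Wh[OF that] that by blast
      obtain u where u: "u \<in> entry_box (- b) b" "U = mat N M u"
        by (rule mat_from_entry_box[OF car(1) b0 Ub])
      obtain vv where vv: "vv \<in> entry_box (- b) b" "Vv = mat (N - 1) M vv"
        by (rule mat_from_entry_box[OF car(2) b0 Vvb])
      obtain vh where vh: "vh \<in> entry_box (- b) b" "Vh = mat N (M - 1) vh"
        by (rule mat_from_entry_box[OF car(3) b0 Vhb])
      obtain wv where wv: "wv \<in> entry_box (\<delta> / 2) b" "Wv = mat (N - 1) M wv"
        by (rule mat_from_entry_box[OF car(4) b Wvb])
      obtain wh where wh: "wh \<in> entry_box (\<delta> / 2) b" "Wh = mat N (M - 1) wh"
        by (rule mat_from_entry_box[OF car(5) b Whb])
      have e: "to_mats N M (u, vv, vh, wv, wh) = Y"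
        by (simp add: to_mats_def Ye u vv vh wv wh)
      moreover have "(u, vv, vh, wv, wh) \<in> Z"
        using u(1) vv(1) vh(1) wv(1) wh(1) U0 Y e by (auto simp: Z_def B_def u(2) simp del: H_fun.simps)
      ultimately show "Y \<in> to_mats N M ` Z" by (metis image_eqI)
    qed
  qed
qed

lemma with_weights_in_Gam:
  assumes "X \<in> feasible N M"
  shows "with_weights \<delta> Cv Ch X \<in> Gam N M \<delta>"
proof (cases X)
  case (fields U Vv Vh)
  have "\<delta> / 2 \<le> weight \<delta> Cv Vv $$ (i, j)" if "i < N - 1" "j < M" for i j
    using weight_ge[OF Cv that delta_pos, of Vv] delta_pos by linarith
  moreover have "\<delta> / 2 \<le> weight \<delta> Ch Vh $$ (i, j)" if "i < N" "j < M - 1" for i j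
    using weight_ge[OF Ch that delta_pos, of Vh] delta_pos by linarith
  ultimately show ?thesis
    using assms fields by (auto simp: feasible_def Gam_def)
qed

text \<open>
  A minimizer \<open>(U, V, W)\<close> of \<open>H\<close> on a sublevel set gives the minimizer \<open>(U, V)\<close> of \<open>F\<close>: a competitor with
  its own weights satisfies \<open>H = F\<close> and either lies in the sublevel set or exceeds its level.
\<close>

lemma F_attains_min:
  obtains X where "X \<in> feasible N M" "\<And>X'. X' \<in> feasible N M \<Longrightarrow> F X \<le> F X'"
proof -
  define X0 :: triple where "X0 = (0\<^sub>m N M, 0\<^sub>m (N - 1) M, 0\<^sub>m N (M - 1))"
  have X0: "X0 \<in> feasible N M"
    by (auto simp: X0_def feasible_def C0_def entry_sum_def)
  let ?S = "{Y \<in> Gam N M \<delta>. H Y \<le> F X0}"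
  obtain Z where Z: "compact Z" "to_mats N M ` Z = ?S" "continuous_on Z (\<lambda>x. H (to_mats N M x))"
    by (rule sublevel_compact_image)
  have "with_weights \<delta> Cv Ch X0 \<in> ?S"
    using with_weights_in_Gam[OF X0] by (simp add: H_with_weights del: F_fun.simps)
  then have "Z \<noteq> {}" using Z(2) by auto
  then obtain z where z: "z \<in> Z" "\<And>y. y \<in> Z \<Longrightarrow> H (to_mats N M z) \<le> H (to_mats N M y)"
    using continuous_attains_inf[OF Z(1) _ Z(3)] by blast
  obtain U Vv Vh Wv Wh where Y: "to_mats N M z = (U, Vv, Vh, Wv, Wh)" by (cases "to_mats N M z")
  have YS: "(U, Vv, Vh, Wv, Wh) \<in> ?S" using z(1) unfolding Y[symmetric] Z(2)[symmetric] by (rule imageI)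
  have min: "H (U, Vv, Vh, Wv, Wh) \<le> H Y'" if "Y' \<in> ?S" for Y'
    using that z(2) Y unfolding Z(2)[symmetric] by auto
  have Wpos: "0 < Wv $$ (i, j)" if "i < N - 1" "j < M" for i j
  proof -
    have "\<delta> / 2 \<le> Wv $$ (i, j)" using YS that by (auto simp: Gam_def)
    then show ?thesis using delta_pos by linarith
  qed
  have Wpos': "0 < Wh $$ (i, j)" if "i < N" "j < M - 1" for i j
  proof -
    have "\<delta> / 2 \<le> Wh $$ (i, j)" using YS that by (auto simp: Gam_def)
    then show ?thesis using delta_pos by linarith
  qed
  have FH: "F (U, Vv, Vh) \<le> H (U, Vv, Vh, Wv, Wh)"
    by (rule F_le_H[OF Wpos Wpos'])
  show thesis
  proof (rule that[of "(U, Vv, Vh)"])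
    show "(U, Vv, Vh) \<in> feasible N M" using YS by (auto simp: feasible_def Gam_def)
    fix X' assume X': "X' \<in> feasible N M"
    show "F (U, Vv, Vh) \<le> F X'"
    proof (cases "F X' \<le> F X0")
      case True
      then have "with_weights \<delta> Cv Ch X' \<in> ?S"
        using with_weights_in_Gam[OF X'] by (simp add: H_with_weights del: F_fun.simps)
      from min[OF this] FH show ?thesis by (simp add: H_with_weights del: F_fun.simps H_fun.simps)
    next
      case False
      have "H (U, Vv, Vh, Wv, Wh) \<le> F X0" using YS by blast
      with FH False show ?thesis by linarith
    qed
  qed
qed

lemma tuple_dist_attains_max:
  assumes "Y0 \<in> Gam N M \<delta>" "Y' \<in> Gam N M \<delta>"
  obtains Y where "Y \<in> Gam N M \<delta>" "H Y \<le> H Y0"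
    "\<And>Y1. Y1 \<in> Gam N M \<delta> \<Longrightarrow> H Y1 \<le> H Y0 \<Longrightarrow> tuple_dist Y1 Y' \<le> tuple_dist Y Y'"
proof -
  obtain Z where Z: "compact Z" "to_mats N M ` Z = {Y \<in> Gam N M \<delta>. H Y \<le> H Y0}"
    by (rule sublevel_compact_image)
  have "continuous_on Z (\<lambda>x. tuple_dist (to_mats N M x) Y')"
    using assms(2) by (cases Y') (auto simp: Gam_def C0_def intro!: continuous_tuple_dist_to_mats simp del: tuple_dist.simps)
  moreover have "Z \<noteq> {}" using Z(2) assms(1) by auto
  ultimately obtain z where z: "z \<in> Z"
    "\<And>y. y \<in> Z \<Longrightarrow> tuple_dist (to_mats N M y) Y' \<le> tuple_dist (to_mats N M z) Y'"
    using continuous_attains_sup[OF Z(1)] by blast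
  have zS: "to_mats N M z \<in> {Y \<in> Gam N M \<delta>. H Y \<le> H Y0}"
    using z(1) unfolding Z(2)[symmetric] by blast
  show thesis
  proof (rule that[of "to_mats N M z"])
    show "to_mats N M z \<in> Gam N M \<delta>" "H (to_mats N M z) \<le> H Y0" using zS by blast+
    fix Y1 assume "Y1 \<in> Gam N M \<delta>" "H Y1 \<le> H Y0"
    then have "Y1 \<in> to_mats N M ` Z" unfolding Z(2) by blast
    then show "tuple_dist Y1 Y' \<le> tuple_dist (to_mats N M z) Y'" using z(2) by auto
  qed
qed

section \<open>Rate of convergence\<close>

lemma slope_ge:
  assumes "U \<in> carrier_mat N M" "Vv \<in> carrier_mat (N - 1) M" "Vh \<in> carrier_mat N (M - 1)"
    and "P \<in> carrier_mat N M" "Qv \<in> carrier_mat (N - 1) M" "Qh \<in> carrier_mat N (M - 1)"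
  shows "- slope U Vv Vh Wv Wh P Qv Qh
    \<le> grad_norm U Vv Vh Wv Wh * sqrt ((frob P)\<^sup>2 + (frob Qv)\<^sup>2 + (frob Qh)\<^sup>2)"
proof -
  note g = grad_carrier[OF assms(1-3)]
  \<comment> \<open>Cauchy-Schwarz for the vectors of the three block norms\<close>
  let ?x = "\<lambda>k::nat. if k = 0 then frob (grad_U U Vv Vh) else if k = 1 then frob (grad_Vv U Vv Wv)
    else frob (grad_Vh U Vh Wh)"
  let ?K = "{0, 1, 2} :: nat set"
  let ?y = "\<lambda>k::nat. if k = 0 then frob P else if k = 1 then frob Qv else frob Qh"
  have "- slope U Vv Vh Wv Wh P Qv Qh \<le> frob (grad_U U Vv Vh) * frob P
      + frob (grad_Vv U Vv Wv) * frob Qv + frob (grad_Vh U Vh Wh) * frob Qh"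
    using frob_inner_le[OF g(1) assms(4)] frob_inner_le[OF g(2) assms(5), of Wv]
      frob_inner_le[OF g(3) assms(6), of Wh]
    unfolding slope_def by linarith
  also have "\<dots> = (\<Sum>k\<in>?K. \<bar>?x k\<bar> * \<bar>?y k\<bar>)"
    by (simp add: frob_nonneg)
  also have "\<dots> \<le> L2_set ?x ?K * L2_set ?y ?K"
    by (rule L2_set_mult_ineq)
  also have "\<dots> = grad_norm U Vv Vh Wv Wh * sqrt ((frob P)\<^sup>2 + (frob Qv)\<^sup>2 + (frob Qh)\<^sup>2)"
    by (simp add: L2_set_def grad_norm_def add.assoc)
  finally show ?thesis .
qed

end

text \<open>
  Dividing \<open>c (a\<^sub>k - a\<^sub>k\<^sub>+\<^sub>1) \<ge> a\<^sub>k\<^sup>2 \<ge> a\<^sub>k a\<^sub>k\<^sub>+\<^sub>1\<close> by \<open>c a\<^sub>k a\<^sub>k\<^sub>+\<^sub>1\<close> shows that the reciprocals grow by at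
  least \<open>1 / c\<close> per step.  The induction is on the product form, which allows \<open>a\<^sub>k = 0\<close> and \<open>c = 0\<close>.
\<close>

lemma quadratic_recursion_rate:
  fixes a :: "nat \<Rightarrow> real"
  assumes "\<And>k. 0 \<le> a k" and "\<And>k. (a k)\<^sup>2 \<le> c * (a k - a (Suc k))" and "0 \<le> c"
  shows "real k * a k \<le> c"
proof (induction k)
  case (Suc k)
  show ?case
  proof (cases "a (Suc k) = 0")
    case False
    then have pos: "0 < a (Suc k)" using assms(1)[of "Suc k"] by simp
    have cpos: "0 < c"
    proof (rule ccontr)
      assume "\<not> 0 < c"
      then have "c = 0" using assms(3) by simp
      then have "(a (Suc k))\<^sup>2 \<le> 0" using assms(2)[of "Suc k"] by simp
      then show False using pos by simp
    qed
    have "0 \<le> c * (a k - a (Suc k))" using assms(2)[of k] zero_le_power2[of "a k"] by linarith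
    then have le: "a (Suc k) \<le> a k" using cpos by (simp add: zero_le_mult_iff)
    have "(real k + 1) * a (Suc k) * a k = (real k * a k) * a (Suc k) + a k * a (Suc k)"
      by (simp add: algebra_simps)
    also have "\<dots> \<le> c * a (Suc k) + a k * a k"
      using Suc.IH le pos assms(1)[of k] by (intro add_mono mult_right_mono mult_left_mono) auto
    also have "\<dots> \<le> c * a k"
      using assms(2)[of k] by (simp add: power2_eq_square algebra_simps)
    finally have "(real k + 1) * a (Suc k) \<le> c"
      by (rule mult_right_le_imp_le) (use le pos in auto)
    then show ?thesis by (simp add: algebra_simps)
  qed (use assms(3) in simp)
qed (use assms(3) in simp)

lemma center_in_C0:
  assumes "A \<in> carrier_mat N M" "0 < N" "0 < M"
  shows "center A \<in> C0 N M"
proof -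
  have "entry_sum (center A) = entry_sum A - real N * real M * (entry_sum A / (real N * real M))"
    using assms by (simp add: entry_sum_def center_def sum_subtractf)
  then show ?thesis
    using assms by (simp add: C0_def) (simp add: center_def)
qed

theorem theorem4:
  fixes N M K :: nat
    and \<tau> \<delta> L R Fstar :: real
    and Cv Ch Gv Gh :: "real mat"
    and U Vv Vh Wv Wh :: "nat \<Rightarrow> real mat"
    and Xstar :: triple
    and Ystar :: quintuple
  assumes "N \<ge> 2" and "M \<ge> 2" and "\<tau> > 0" and "\<delta> > 0"
    and "Cv \<in> carrier_mat (N - 1) M" and "Ch \<in> carrier_mat N (M - 1)"
    and "Gv \<in> carrier_mat (N - 1) M" and "Gh \<in> carrier_mat N (M - 1)"
    and "\<And>i j. i < N - 1 \<Longrightarrow> j < M \<Longrightarrow> Cv $$ (i, j) > 0"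
    and "\<And>i j. i < N \<Longrightarrow> j < M - 1 \<Longrightarrow> Ch $$ (i, j) > 0"
    and "L = 12 / \<tau> + 1 / \<delta> * (C_max Cv Ch)\<^sup>2"
    and "irls_sequence N M \<delta> Cv Ch Gv Gh U Vv Vh Wv Wh"
    and "\<And>k. H_fun N M \<tau> \<delta> Cv Ch Gv Gh (U (Suc k), Vv (Suc k), Vh (Suc k), Wv k, Wh k)
              \<le> H_fun N M \<tau> \<delta> Cv Ch Gv Gh
                  (candidate N M \<tau> L Cv Ch Gv Gh (U k, Vv k, Vh k, Wv k, Wh k))"
    and "Fstar = (LEAST c. c \<in> F_fun N M \<tau> \<delta> Cv Ch Gv Gh ` feasible N M)"
    and "Xstar = arg_min_on (F_fun N M \<tau> \<delta> Cv Ch Gv Gh) (feasible N M)"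
    and "Ystar = with_weights \<delta> Cv Ch Xstar"
    and "R = (GREATEST r. r \<in> {tuple_dist Y Ystar | Y. Y \<in> Gam N M \<delta> \<and>
                H_fun N M \<tau> \<delta> Cv Ch Gv Gh Y
                  \<le> H_fun N M \<tau> \<delta> Cv Ch Gv Gh (U 0, Vv 0, Vh 0, Wv 0, Wh 0)})"
    and "K \<ge> 2"
  shows "F_fun N M \<tau> \<delta> Cv Ch Gv Gh (U K, Vv K, Vh K) - Fstar
           \<le> max ((1 / 2) powr ((real K - 1) / 2)) (8 * L * R\<^sup>2 / (real K - 1))"
proof -
  interpret irls_problem N M \<tau> \<delta> Cv Ch Gv Gh
    by unfold_locales (use assms(3-10) in auto)
  have irls: "U 0 = 0\<^sub>m N M" "Vv 0 = S_mat N * U 0 - Gv" "Vh 0 = U 0 * T_mat M - Gh"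
    and weights: "\<And>k. Wv k = weight \<delta> Cv (Vv k)" "\<And>k. Wh k = weight \<delta> Ch (Vh k)"
    and USuc: "\<And>k. \<exists>Uhat\<in>carrier_mat N M. U (Suc k) = center Uhat"
    and VSuc: "\<And>k. Vv (Suc k) \<in> carrier_mat (N - 1) M" "\<And>k. Vh (Suc k) \<in> carrier_mat N (M - 1)"
    using assms(12) unfolding irls_sequence_def by blast+
  define X where "X k = (U k, Vv k, Vh k)" for k
  define Y where "Y k = (U k, Vv k, Vh k, Wv k, Wh k)" for k
  have Xfeas: "X k \<in> feasible N M" for k
  proof (cases k)
    case 0
    have "U 0 \<in> C0 N M" using irls(1) by (simp add: C0_def entry_sum_def)
    moreover have "U 0 \<in> carrier_mat N M" using irls(1) by simp
    ultimately show ?thesis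
      using irls(2,3) Gv Gh 0 unfolding X_def feasible_def by (auto intro!: minus_carrier_mat)
  next
    case (Suc l)
    then show ?thesis
      using USuc[of l] VSuc[of l] center_in_C0[of _ N M] assms(1,2)
      unfolding X_def feasible_def by auto
  qed
  have car: "U k \<in> carrier_mat N M" "Vv k \<in> carrier_mat (N - 1) M" "Vh k \<in> carrier_mat N (M - 1)" for k
    using Xfeas[of k] by (auto simp: X_def feasible_def C0_def)
  have Yw: "Y k = with_weights \<delta> Cv Ch (X k)" for k
    by (simp add: X_def Y_def weights)
  have HY: "H (Y k) = F (X k)" for k
    unfolding Yw by (rule H_with_weights)
  have Wge: "\<And>i j. i < N - 1 \<Longrightarrow> j < M \<Longrightarrow> \<delta> \<le> Wv k $$ (i, j)"
    "\<And>i j. i < N \<Longrightarrow> j < M - 1 \<Longrightarrow> \<delta> \<le> Wh k $$ (i, j)" for k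
    using weight_ge[OF Cv _ _ delta_pos] weight_ge[OF Ch _ _ delta_pos] by (auto simp: weights)
  have Wpos: "\<And>i j. i < N - 1 \<Longrightarrow> j < M \<Longrightarrow> 0 < Wv k $$ (i, j)"
    "\<And>i j. i < N \<Longrightarrow> j < M - 1 \<Longrightarrow> 0 < Wh k $$ (i, j)" for k
    using Wge delta_pos less_le_trans by blast+
  have Wcar: "Wv k \<in> carrier_mat (N - 1) M" "Wh k \<in> carrier_mat N (M - 1)" for k
    by (simp_all add: weights)
  define g where "g k = grad_norm (U k) (Vv k) (Vh k) (Wv k) (Wh k)" for k
  have L0: "0 < L" using tau_pos delta_pos unfolding assms(11) by (intro add_pos_nonneg) auto
  have step: "F (X (Suc k)) \<le> F (X k) - (g k)\<^sup>2 / (2 * L)" for k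
  proof -
    have "F (X (Suc k)) \<le> H (U (Suc k), Vv (Suc k), Vh (Suc k), Wv k, Wh k)"
      unfolding X_def by (rule F_le_H[OF Wpos])
    also have "\<dots> \<le> H (candidate N M \<tau> L Cv Ch Gv Gh (U k, Vv k, Vh k, Wv k, Wh k))"
      by (rule assms(13))
    also have "\<dots> \<le> H (Y k) - (g k)\<^sup>2 / (2 * L)"
      unfolding Y_def g_def by (rule H_descent[OF car Wcar Wge assms(11)])
    finally show ?thesis unfolding HY .
  qed
  have mono: "F (X k) \<le> F (X 0)" for k
  proof (induction k)
    case (Suc k)
    have "0 \<le> (g k)\<^sup>2 / (2 * L)" using L0 by simp
    then show ?case using step[of k] Suc.IH by linarith
  qed simp
  \<comment> \<open>\<open>arg_min_on\<close>, \<open>LEAST\<close> and \<open>GREATEST\<close> are meaningful only because the extrema are attained.\<close>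
  obtain Xm where Xm: "Xm \<in> feasible N M" "\<And>X'. X' \<in> feasible N M \<Longrightarrow> F Xm \<le> F X'"
    by (rule F_attains_min) blast
  have "is_arg_min F (\<lambda>x. x \<in> feasible N M) Xstar"
    unfolding assms(15) arg_min_on_def arg_min_def
    by (rule someI[of _ Xm]) (use Xm in \<open>auto simp: is_arg_min_linorder simp del: F_fun.simps\<close>)
  then have Xs: "Xstar \<in> feasible N M" "\<And>X'. X' \<in> feasible N M \<Longrightarrow> F Xstar \<le> F X'"
    by (auto simp: is_arg_min_linorder simp del: F_fun.simps)
  have Fs: "Fstar = F Xstar"
    unfolding assms(14) by (rule Least_equality) (use Xs in \<open>auto simp del: F_fun.simps\<close>)
  have YG: "Y k \<in> Gam N M \<delta>" for k unfolding Yw by (rule with_weights_in_Gam[OF Xfeas])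
  have YsG: "Ystar \<in> Gam N M \<delta>" unfolding assms(16) by (rule with_weights_in_Gam[OF Xs(1)])
  obtain Ym where Ym: "Ym \<in> Gam N M \<delta>" "H Ym \<le> H (Y 0)"
    "\<And>Y1. Y1 \<in> Gam N M \<delta> \<Longrightarrow> H Y1 \<le> H (Y 0) \<Longrightarrow> tuple_dist Y1 Ystar \<le> tuple_dist Ym Ystar"
    by (rule tuple_dist_attains_max[OF YG[of 0] YsG]) blast
  have R: "R = tuple_dist Ym Ystar"
    unfolding assms(17) Y_def[symmetric]
    by (rule Greatest_equality) (use Ym in blast)+
  have distR: "tuple_dist (Y k) Ystar \<le> R" for k
    unfolding R by (rule Ym(3)[OF YG]) (use mono in \<open>simp add: HY del: H_fun.simps F_fun.simps\<close>)
  obtain Us Vvs Vhs where Xse: "Xstar = (Us, Vvs, Vhs)" by (cases Xstar)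
  have cars: "Us \<in> carrier_mat N M" "Vvs \<in> carrier_mat (N - 1) M" "Vhs \<in> carrier_mat N (M - 1)"
    using Xs(1) Xse by (auto simp: feasible_def C0_def)
  define a where "a k = F (X k) - Fstar" for k
  have a0: "0 \<le> a k" for k using Xs(2)[OF Xfeas] Fs by (simp add: a_def del: F_fun.simps)
  \<comment> \<open>Every iterate with its own weights lies in the sublevel set over which \<open>R\<close> is the maximum.\<close>
  have gap: "a k \<le> g k * R" for k
  proof -
    let ?P = "Us - U k" and ?Qv = "Vvs - Vv k" and ?Qh = "Vhs - Vh k"
    have c: "?P \<in> carrier_mat N M" "?Qv \<in> carrier_mat (N - 1) M" "?Qh \<in> carrier_mat N (M - 1)"
      using car[of k] by (auto intro!: minus_carrier_mat)
    have e: "U k + ?P = Us" "Vv k + ?Qv = Vvs" "Vh k + ?Qh = Vhs"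
      using car[of k] cars by (auto intro!: eq_matI)
    have "a k \<le> - slope (U k) (Vv k) (Vh k) (Wv k) (Wh k) ?P ?Qv ?Qh"
      using F_above_tangent[OF car[of k] c] unfolding e weights[symmetric] a_def X_def Fs Xse by linarith
    also have "\<dots> \<le> g k * sqrt ((frob ?P)\<^sup>2 + (frob ?Qv)\<^sup>2 + (frob ?Qh)\<^sup>2)"
      unfolding g_def by (rule slope_ge[OF car c])
    also have "\<dots> \<le> g k * R"
    proof (rule mult_left_mono)
      have sym: "(frob (A - B))\<^sup>2 = (frob (B - A))\<^sup>2"
        if "A \<in> carrier_mat n m" "B \<in> carrier_mat n m" for A B n m
        using that by (simp add: frob_square[where n = n and m = m] minus_carrier_mat power2_commute)
      have "sqrt ((frob ?P)\<^sup>2 + (frob ?Qv)\<^sup>2 + (frob ?Qh)\<^sup>2) \<le> tuple_dist (Y k) Ystar"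
        unfolding Y_def assms(16) Xse with_weights.simps tuple_dist.simps
          sym[OF cars(1) car(1)] sym[OF cars(2) car(2)] sym[OF cars(3) car(3)]
        by (intro real_sqrt_le_mono) simp
      then show "sqrt ((frob ?P)\<^sup>2 + (frob ?Qv)\<^sup>2 + (frob ?Qh)\<^sup>2) \<le> R" using distR[of k] by linarith
      show "0 \<le> g k" by (simp add: g_def grad_norm_def)
    qed
    finally show ?thesis .
  qed
  have "(a k)\<^sup>2 \<le> 2 * L * R\<^sup>2 * (a k - a (Suc k))" for k
  proof -
    have "(a k)\<^sup>2 \<le> (g k * R)\<^sup>2" using gap a0 by (intro power_mono) auto
    also have "\<dots> = R\<^sup>2 * (g k)\<^sup>2" by (simp add: power_mult_distrib)
    also have "\<dots> \<le> R\<^sup>2 * (2 * L * (a k - a (Suc k)))"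
      using step[of k] L0 by (intro mult_left_mono) (auto simp: a_def field_simps simp del: F_fun.simps)
    finally show ?thesis by (simp add: algebra_simps)
  qed
  then have "real K * a K \<le> 2 * L * R\<^sup>2"
    using a0 L0 by (intro quadratic_recursion_rate) auto
  moreover have "0 \<le> L * R\<^sup>2" using L0 by simp
  ultimately have "(real K - 1) * a K \<le> 8 * L * R\<^sup>2"
    using a0[of K] unfolding left_diff_distrib by linarith
  then have "a K \<le> 8 * L * R\<^sup>2 / (real K - 1)"
    using assms(18) by (simp add: pos_le_divide_eq mult.commute)
  then show ?thesis unfolding a_def X_def by simp
qed

end
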